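(* Let $X$ and $Y$ be Banach spaces and let $G \subseteq \mathcal{L}(X)$ be a compact group of isometries. If $Y$ has property quasi-$\beta$-$H$ for some group of isometries $H \subseteq \mathcal{L}(Y)$, then $$\{ T \in \operatorname{NA}_G(X, Y): T^* \in \mathcal{L}_{H^*}(Y^*, X^* )\}$$ is dense in $\{T \in \mathcal{L}_G(X, Y): T^* \in \mathcal{L}_{H^*}(Y^*, X^* )\}$.
   Context: Banach spaces are over $\mathbb{K}\in\{\mathbb{R},\mathbb{C}\}$; $B_Z$, $S_Z$, $Z^*$ denote the closed unit ball, unit sphere and dual of $Z$; $\operatorname{ext}(B)$ is the set of extreme points of $B$; $\mathbb{T}$ is the set of scalars of modulus $1$. $\mathcal{L}(X,Y)$ is the space of bounded linear operators with the operator norm, $\mathcal{L}(X)=\mathcal{L}(X,X)$. A group $G\subseteq\mathcal{L}(X)$ is a group (under composition) of invertible bounded linear maps on $X$ endowed with the operator norm topology, and "compact" refers to this topology; "group of isometries" means every element is an isometric isomorphism. $T\in\mathcal{L}(X,Y)$ is $G$-invariant if $T(g(x))=T(x)$ for all $x\in X$, $g\in G$; $\mathcal{L}_G(X,Y)$ is the set of $G$-invariant operators. $T$ is norm-attaining if there is $x_0\in B_X$ with $\|T(x_0)\|=\|T\|$; $\operatorname{NA}_G(X,Y)$ is the set of norm-attaining $T\in\mathcal{L}_G(X,Y)$. For a group $H\subseteq\mathcal{L}(Y)$, $H^*=\{h^*:h\in H\}\subseteq\mathcal{L}(Y^* )$ is the group of adjoints, so $T^*\in\mathcal{L}_{H^*}(Y^*,X^*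 )$ means $T^*\circ h^*=T^*$ for all $h\in H$. Density is in the operator norm. Property quasi-$\beta$-$H$: $Y$ has this property (for a group of isometries $H\subseteq\mathcal{L}(Y)$) if there exist $A=\{y_\lambda:\lambda\in\Lambda\}\subseteq S_Y$, $A^*=\{y_\lambda^*:\lambda\in\Lambda\}\subseteq S_{Y^*}$ and a function $\rho:A^*\to\mathbb{R}$ such that (i) $h(y_\lambda)=y_\lambda$ for all $h\in H$ and $\lambda\in\Lambda$; (ii) $y_\lambda^*(y_\lambda)=1$ for every $\lambda\in\Lambda$; (iii) $|y_\mu^*(y_\lambda)|\le\rho(y_\lambda^* )<1$ whenever $\lambda\ne\mu$ in $\Lambda$; (iv) for every $e^*\in\operatorname{ext}(B_{Y^*})$ there exist a subset $A_{e^*}\subseteq A^*$ and $t\in\mathbb{T}$ such that $te^*\in\overline{\{h^*(y^* ):h\in H,\ y^*\in A_{e^*}\}}^{w^*}$ and $r_{e^*}:=\sup\{\rho(y^* ):y^*\in A_{e^*}\}<1$. *)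

theory Defs
  imports "HOL-Analysis.Analysis"
begin

text \<open>
  The scalar field \<open>\<bbbK>\<close> is a type \<open>'k\<close> that is isometrically isomorphic, as a field and over the
  reals, to \<open>\<real>\<close> or \<open>\<complex>\<close>, so that real and complex spaces are covered by a single statement.
\<close>

class real_or_complex = real_normed_field +
  assumes iso_real_or_complex:
    "\<exists>\<phi>::'a \<Rightarrow> complex. (\<forall>x y. \<phi> (x + y) = \<phi> x + \<phi> y) \<and> (\<forall>r x. \<phi> (r *\<^sub>R x) = r *\<^sub>R \<phi> x)
       \<and> (\<forall>x y. \<phi> (x * y) = \<phi> x * \<phi> y) \<and> (\<forall>x. norm (\<phi> x) = norm x)
       \<and> (range \<phi> = \<real> \<or> range \<phi> = UNIV)"

instance real :: real_or_complex
proof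
  show "\<exists>\<phi>::real \<Rightarrow> complex. (\<forall>x y. \<phi> (x + y) = \<phi> x + \<phi> y) \<and> (\<forall>r x. \<phi> (r *\<^sub>R x) = r *\<^sub>R \<phi> x)
       \<and> (\<forall>x y. \<phi> (x * y) = \<phi> x * \<phi> y) \<and> (\<forall>x. norm (\<phi> x) = norm x)
       \<and> (range \<phi> = \<real> \<or> range \<phi> = UNIV)"
    by (rule exI[of _ complex_of_real])
      (auto simp: Reals_def scaleR_conv_of_real norm_mult)
qed

instance complex :: real_or_complex
proof
  show "\<exists>\<phi>::complex \<Rightarrow> complex. (\<forall>x y. \<phi> (x + y) = \<phi> x + \<phi> y) \<and> (\<forall>r x. \<phi> (r *\<^sub>R x) = r *\<^sub>R \<phi> x)
       \<and> (\<forall>x y. \<phi> (x * y) = \<phi> x * \<phi> y) \<and> (\<forall>x. norm (\<phi> x) = norm x)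
       \<and> (range \<phi> = \<real> \<or> range \<phi> = UNIV)"
    by (rule exI[of _ id]) auto
qed

text \<open>
  A Banach space over \<open>'k\<close> is a type of class \<open>banach\<close> (which carries the norm, the topology and
  the scalar multiplication by reals) with a scalar multiplication by \<open>'k\<close> that extends the real
  one and is compatible with the norm.
\<close>

locale banach_over = vector_space scale
  for scale :: "'k::real_or_complex \<Rightarrow> 'a::banach \<Rightarrow> 'a" +
  assumes scale_of_real: "scale (of_real r) x = r *\<^sub>R x"
    and norm_scale: "norm (scale c x) = norm c * norm x"

text \<open>
  Bounded \<open>'k\<close>-linear maps between the subspaces \<open>V\<close> and \<open>W\<close>. The carriers are needed because
  \<open>Z\<^sup>*\<close> is a subspace of the type of all bounded real-linear maps into \<open>'k\<close>.
\<close>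

definition bounded_ops ::
  "('k \<Rightarrow> 'a \<Rightarrow> 'a) \<Rightarrow> 'a::real_normed_vector set \<Rightarrow> ('k \<Rightarrow> 'b \<Rightarrow> 'b) \<Rightarrow> 'b::real_normed_vector set
     \<Rightarrow> ('a \<Rightarrow> 'b) set"
  where "bounded_ops sV V sW W =
    {T. T ` V \<subseteq> W
      \<and> (\<forall>x\<in>V. \<forall>y\<in>V. T (x + y) = T x + T y)
      \<and> (\<forall>c. \<forall>x\<in>V. T (sV c x) = sW c (T x))
      \<and> (\<exists>B. \<forall>x\<in>V. norm (T x) \<le> B * norm x)}"

definition invariant_ops ::
  "('k \<Rightarrow> 'a \<Rightarrow> 'a) \<Rightarrow> 'a::real_normed_vector set \<Rightarrow> ('k \<Rightarrow> 'b \<Rightarrow> 'b) \<Rightarrow> 'b::real_normed_vector set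
     \<Rightarrow> ('a \<Rightarrow> 'a) set \<Rightarrow> ('a \<Rightarrow> 'b) set"
  where "invariant_ops sV V sW W \<Gamma> =
    {T \<in> bounded_ops sV V sW W. \<forall>g\<in>\<Gamma>. \<forall>x\<in>V. T (g x) = T x}"

text \<open>
  \<open>L(X,Y)\<close> and \<open>L\<^sub>G(X,Y)\<close> as subsets of \<open>X \<Rightarrow>\<^sub>L Y\<close>, whose norm is the operator norm.
\<close>

definition ops :: "('k \<Rightarrow> 'a \<Rightarrow> 'a) \<Rightarrow> ('k \<Rightarrow> 'b \<Rightarrow> 'b)
    \<Rightarrow> ('a::real_normed_vector \<Rightarrow>\<^sub>L 'b::real_normed_vector) set"
  where "ops sX sY = {T. blinfun_apply T \<in> bounded_ops sX UNIV sY UNIV}"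

definition inv_ops :: "('k \<Rightarrow> 'a \<Rightarrow> 'a) \<Rightarrow> ('k \<Rightarrow> 'b \<Rightarrow> 'b) \<Rightarrow> ('a \<Rightarrow>\<^sub>L 'a) set
    \<Rightarrow> ('a::real_normed_vector \<Rightarrow>\<^sub>L 'b::real_normed_vector) set"
  where "inv_ops sX sY G =
    {T. blinfun_apply T \<in> invariant_ops sX UNIV sY UNIV (blinfun_apply ` G)}"

definition norm_attaining ::
  "('a::real_normed_vector \<Rightarrow>\<^sub>L 'b::real_normed_vector) \<Rightarrow> bool"
  where "norm_attaining T \<longleftrightarrow> (\<exists>x\<in>cball 0 1. norm (T x) = norm T)"

definition NA_inv :: "('k \<Rightarrow> 'a \<Rightarrow> 'a) \<Rightarrow> ('k \<Rightarrow> 'b \<Rightarrow> 'b) \<Rightarrow> ('a \<Rightarrow>\<^sub>L 'a) set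
    \<Rightarrow> ('a::real_normed_vector \<Rightarrow>\<^sub>L 'b::real_normed_vector) set"
  where "NA_inv sX sY G = {T \<in> inv_ops sX sY G. norm_attaining T}"

definition operator_group ::
  "('k \<Rightarrow> 'a \<Rightarrow> 'a) \<Rightarrow> ('a::real_normed_vector \<Rightarrow>\<^sub>L 'a) set \<Rightarrow> bool"
  where "operator_group sX G \<longleftrightarrow>
    G \<subseteq> ops sX sX \<and> id_blinfun \<in> G \<and> (\<forall>g\<in>G. \<forall>h\<in>G. g o\<^sub>L h \<in> G)
    \<and> (\<forall>g\<in>G. \<exists>h\<in>G. g o\<^sub>L h = id_blinfun \<and> h o\<^sub>L g = id_blinfun)"

definition isometry_group ::
  "('k \<Rightarrow> 'a \<Rightarrow> 'a) \<Rightarrow> ('a::real_normed_vector \<Rightarrow>\<^sub>L 'a) set \<Rightarrow> bool"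
  where "isometry_group sX G \<longleftrightarrow> operator_group sX G \<and> (\<forall>g\<in>G. \<forall>x. norm (g x) = norm x)"

definition dual :: "('k \<Rightarrow> 'a \<Rightarrow> 'a)
    \<Rightarrow> ('a::real_normed_vector \<Rightarrow>\<^sub>L 'k::real_or_complex) set"
  where "dual sX = ops sX (*)"

definition dual_scale ::
  "'k::real_or_complex \<Rightarrow> ('a::real_normed_vector \<Rightarrow>\<^sub>L 'k) \<Rightarrow> ('a \<Rightarrow>\<^sub>L 'k)"
  where "dual_scale c f = blinfun_mult_right c o\<^sub>L f"

definition adjoint_op :: "('a::real_normed_vector \<Rightarrow>\<^sub>L 'b::real_normed_vector)
    \<Rightarrow> ('b \<Rightarrow>\<^sub>L 'k::real_or_complex) \<Rightarrow> ('a \<Rightarrow>\<^sub>L 'k)"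
  where "adjoint_op T f = f o\<^sub>L T"

text \<open>
  \<open>L\<^sub>\<Gamma>(Y\<^sup>*, X\<^sup>*)\<close> for a set \<open>\<Gamma>\<close> of operators on \<open>Y\<^sup>*\<close>.
\<close>

definition dual_inv_ops :: "('k::real_or_complex \<Rightarrow> 'b \<Rightarrow> 'b) \<Rightarrow> ('k \<Rightarrow> 'a \<Rightarrow> 'a)
    \<Rightarrow> (('b::real_normed_vector \<Rightarrow>\<^sub>L 'k) \<Rightarrow> ('b \<Rightarrow>\<^sub>L 'k)) set
    \<Rightarrow> (('b \<Rightarrow>\<^sub>L 'k) \<Rightarrow> ('a::real_normed_vector \<Rightarrow>\<^sub>L 'k)) set"
  where "dual_inv_ops sY sX \<Gamma> = invariant_ops dual_scale (dual sY) dual_scale (dual sX) \<Gamma>"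

text \<open>
  On functionals, the strong operator topology is the topology of pointwise convergence, so its
  restriction to the dual space is the weak-star topology.
\<close>

definition weak_star :: "('k \<Rightarrow> 'a \<Rightarrow> 'a)
    \<Rightarrow> ('a::real_normed_vector \<Rightarrow>\<^sub>L 'k::real_or_complex) topology"
  where "weak_star sX = subtopology strong_operator_topology (dual sX)"

text \<open>
  Property quasi-\<open>\<beta>\<close>-\<open>H\<close>. The type \<open>'i\<close> of indices is a parameter, since a formula cannot quantify
  over types. In (iv) the set \<open>B\<close> is automatically nonempty, as the closure contains \<open>t e\<^sup>*\<close>,
  and \<open>\<rho>\<close> is bounded above on \<open>B\<close> (by (iii), or because \<open>\<Lambda>\<close> is a singleton), so the real supremum is the intended one.
\<close>

definition quasi_beta_family :: "('k::real_or_complex \<Rightarrow> 'b \<Rightarrow> 'b)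
    \<Rightarrow> ('b::real_normed_vector \<Rightarrow>\<^sub>L 'b) set \<Rightarrow> 'i set \<Rightarrow> ('i \<Rightarrow> 'b) \<Rightarrow> ('i \<Rightarrow> 'b \<Rightarrow>\<^sub>L 'k)
    \<Rightarrow> (('b \<Rightarrow>\<^sub>L 'k) \<Rightarrow> real) \<Rightarrow> bool"
  where "quasi_beta_family sY H \<Lambda> y ys \<rho> \<longleftrightarrow>
    y ` \<Lambda> \<subseteq> sphere 0 1 \<and> ys ` \<Lambda> \<subseteq> dual sY \<inter> sphere 0 1
    \<and> (\<forall>h\<in>H. \<forall>i\<in>\<Lambda>. blinfun_apply h (y i) = y i)
    \<and> (\<forall>i\<in>\<Lambda>. blinfun_apply (ys i) (y i) = 1)
    \<and> (\<forall>i\<in>\<Lambda>. \<forall>j\<in>\<Lambda>. i \<noteq> j \<longrightarrow> norm (blinfun_apply (ys j) (y i)) \<le> \<rho> (ys i) \<and> \<rho> (ys i) < 1)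
    \<and> (\<forall>e. e extreme_point_of (dual sY \<inter> cball 0 1) \<longrightarrow>
         (\<exists>B \<subseteq> ys ` \<Lambda>. \<exists>t. norm t = 1
            \<and> dual_scale t e \<in> weak_star sY closure_of {adjoint_op h f | h f. h \<in> H \<and> f \<in> B}
            \<and> (SUP f\<in>B. \<rho> f) < 1))"

definition quasi_beta :: "'i itself \<Rightarrow> ('k::real_or_complex \<Rightarrow> 'b \<Rightarrow> 'b)
    \<Rightarrow> ('b::real_normed_vector \<Rightarrow>\<^sub>L 'b) set \<Rightarrow> bool"
  where "quasi_beta TYPE('i) sY H \<longleftrightarrow>
    (\<exists>(\<Lambda> :: 'i set) y ys \<rho>. quasi_beta_family sY H \<Lambda> y ys \<rho>)"

end

theory Submission
  imports Defs
begin

text \<open>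
  Testing against norming functionals, the condition on \<open>T\<^sup>*\<close> says \<open>h \<circ> T = T\<close> for all \<open>h \<in> H\<close>. The
  class of operators in question is therefore \<open>invariant_operators\<close>: those unchanged by composition
  with \<open>G\<close> on the right and with \<open>H\<close> on the left. It is closed, and it is stable under adding
  \<open>x \<mapsto> \<phi> x \<cdot> y\<close> whenever \<open>\<phi>\<close> is \<open>G\<close>-invariant and \<open>y\<close> is fixed by \<open>H\<close>. Both perturbations made below are
  of this kind.

  The first perturbation is Lindenstrauss' iteration (\<open>lindenstrauss_iteration\<close>). The rank one terms
  added to \<open>T\<close> are built from the current operator itself, so invariance is preserved for free. The limit
  \<open>S\<close> comes with points \<open>x\<^sub>k\<close> of the unit ball such that finitely many of the \<open>S x\<^sub>k\<close> always are almost
  normed by one and the same functional. From this an extreme point \<open>e\<close> of the dual ball of \<open>Y\<close> is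
  extracted with \<open>\<bar>e (S x\<^sub>k)\<bar>\<close> arbitrarily close to \<open>norm S\<close>: the adjoint of \<open>S\<close> attains its norm at an
  extreme point (\<open>extreme_functional_norming_sequence\<close>). This is where (iv) enters: the set belonging to \<open>e\<close>
  provides an index \<open>i\<close> for which \<open>y\<^sub>i\<^sup>* \<circ> S\<close> has norm almost \<open>norm S\<close>, while \<open>\<rho> (y\<^sub>i\<^sup>*)\<close> stays below a
  bound \<open>r < 1\<close> that depends on \<open>e\<close> only.

  The second perturbation turns \<open>y\<^sub>i\<^sup>* \<circ> S\<close> into a norm attaining functional. By the Bishop-Phelps theorem
  it is close to a norm attaining functional \<open>z\<close>. To keep \<open>z\<close> invariant, the theorem is applied on
  the space of \<open>G\<close>-fixed vectors, which is the range of a projection of norm at most one: the mean over the compact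
  group \<open>G\<close> (\<open>invariant_mean\<close>, \<open>bishop_phelps_invariant\<close>). Replacing \<open>y\<^sub>i\<^sup>* \<circ> S\<close> by \<open>(1 + \<eta>) z\<close> in the direction of \<open>y\<^sub>i\<close>
  gives the operator \<open>R\<close>. By (ii) its \<open>i\<close>-th component is \<open>(1 + \<eta>) z\<close>; by (iii) the change of every other
  component is damped by the factor \<open>r\<close>, so the \<open>i\<close>-th component determines \<open>norm R\<close> and \<open>R\<close> attains its norm
  where \<open>z\<close> does (\<open>norm_attaining_rank_one_perturbation\<close>).

  Hahn-Banach, the existence of extreme points, and the sandwich theorem behind Bishop-Phelps all come from
  one application of Zorn's lemma: a minimal element among the sublinear functionals whose linear
  minorants form a face is linear, and it is an extreme point (\<open>extreme_linear_minorant\<close>). This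
  algebraic argument takes the place of weak-star compactness.
\<close>

section \<open>Sublinear functionals and extreme linear minorants\<close>

definition sublinear :: "('a::real_vector \<Rightarrow> real) \<Rightarrow> bool"
  where "sublinear p \<longleftrightarrow>
    (\<forall>x y. p (x + y) \<le> p x + p y) \<and> (\<forall>t\<ge>0. \<forall>x. p (t *\<^sub>R x) = t * p x)"

lemma sublinear_add: "sublinear p \<Longrightarrow> p (x + y) \<le> p x + p y"
  by (simp add: sublinear_def)

lemma sublinear_scaleR: "sublinear p \<Longrightarrow> 0 \<le> t \<Longrightarrow> p (t *\<^sub>R x) = t * p x"
  by (simp add: sublinear_def)

lemma sublinear_0: "sublinear p \<Longrightarrow> p 0 = 0"
  using sublinear_scaleR[of p 0 0] by simp

lemma sublinear_ge: "sublinear p \<Longrightarrow> - p (- x) \<le> p x"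
  using sublinear_add[of p x "- x"] sublinear_0[of p] by simp

lemma sublinear_norm: "0 \<le> B \<Longrightarrow> sublinear (\<lambda>x::'a::real_normed_vector. B * norm x)"
  unfolding sublinear_def
  by (auto simp: mult_left_mono[OF norm_triangle_ineq] simp flip: distrib_left)

text \<open>
  A linear functional lies below \<open>tighten p C\<close> iff it lies below \<open>p\<close> and satisfies the lower bounds
  \<open>a \<le> f w\<close> for all \<open>(w, a) \<in> C\<close> (\<open>linear_le_tighten_iff\<close>). So this operation encodes side conditions on
  functionals into the sublinear functional that dominates them.
\<close>

definition tighten :: "('a::real_vector \<Rightarrow> real) \<Rightarrow> ('a \<times> real) set \<Rightarrow> 'a \<Rightarrow> real"
  where "tighten p C v = (INF c\<in>C. p (v + fst c) - snd c)"

text \<open>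
  The last condition is the necessary one for some linear minorant of \<open>p\<close> to satisfy the bounds in \<open>C\<close>,
  and it is also what keeps the infimum in \<open>tighten\<close> finite.
\<close>

definition compatible_cone :: "('a::real_vector \<Rightarrow> real) \<Rightarrow> ('a \<times> real) set \<Rightarrow> bool"
  where "compatible_cone p C \<longleftrightarrow> (0, 0) \<in> C \<and> (\<forall>c\<in>C. \<forall>d\<in>C. c + d \<in> C)
    \<and> (\<forall>t>0. \<forall>c\<in>C. t *\<^sub>R c \<in> C) \<and> (\<forall>c\<in>C. snd c \<le> p (fst c))"

lemma tighten_bounded_below:
  assumes "sublinear p" "compatible_cone p C" "c \<in> C"
  shows "- p (- v) \<le> p (v + fst c) - snd c"
  using sublinear_add[OF assms(1), of "v + fst c" "- v"] assms(2,3)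
  unfolding compatible_cone_def by fastforce

lemma tighten_le:
  assumes "sublinear p" "compatible_cone p C" "c \<in> C"
  shows "tighten p C v \<le> p (v + fst c) - snd c"
  unfolding tighten_def
  by (rule cINF_lower[OF _ assms(3)])
    (meson bdd_below.I2 tighten_bounded_below[OF assms(1,2)])

lemma le_tighten:
  assumes "compatible_cone p C" "\<And>c. c \<in> C \<Longrightarrow> m \<le> p (v + fst c) - snd c"
  shows "m \<le> tighten p C v"
  unfolding tighten_def using assms by (intro cINF_greatest) (auto simp: compatible_cone_def)

lemma tighten_le_self: "sublinear p \<Longrightarrow> compatible_cone p C \<Longrightarrow> tighten p C \<le> p"
  using tighten_le[of p C "(0, 0)"] by (auto simp: le_fun_def compatible_cone_def)

lemma sublinear_tighten:
  assumes p: "sublinear p" and C: "compatible_cone p C"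
  shows "sublinear (tighten p C)"
proof -
  have add: "tighten p C (x + y) \<le> tighten p C x + tighten p C y" for x y
  proof -
    have "tighten p C (x + y) - (p (y + fst d) - snd d) \<le> tighten p C x" if d: "d \<in> C" for d
    proof (rule le_tighten[OF C])
      fix c assume c: "c \<in> C"
      have "tighten p C (x + y) \<le> p ((x + y) + fst (c + d)) - snd (c + d)"
        using c d C by (intro tighten_le[OF p C]) (auto simp: compatible_cone_def)
      also have "(x + y) + fst (c + d) = (x + fst c) + (y + fst d)" by simp
      also have "p \<dots> \<le> p (x + fst c) + p (y + fst d)" by (rule sublinear_add[OF p])
      finally show "tighten p C (x + y) - (p (y + fst d) - snd d) \<le> p (x + fst c) - snd c"
        by simp
    qed
    then have "tighten p C (x + y) - tighten p C x \<le> tighten p C y"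
      by (intro le_tighten[OF C]) (simp add: algebra_simps)
    then show ?thesis by simp
  qed
  have le: "tighten p C (t *\<^sub>R x) \<le> t * tighten p C x" if t: "t > 0" for t x
  proof -
    have "tighten p C (t *\<^sub>R x) / t \<le> tighten p C x"
    proof (rule le_tighten[OF C])
      fix c assume c: "c \<in> C"
      have "tighten p C (t *\<^sub>R x) \<le> p (t *\<^sub>R x + fst (t *\<^sub>R c)) - snd (t *\<^sub>R c)"
        using c t C by (intro tighten_le[OF p C]) (auto simp: compatible_cone_def)
      also have "t *\<^sub>R x + fst (t *\<^sub>R c) = t *\<^sub>R (x + fst c)" by (simp add: scaleR_add_right)
      also have "p \<dots> = t * p (x + fst c)" using t by (simp add: sublinear_scaleR[OF p])
      finally show "tighten p C (t *\<^sub>R x) / t \<le> p (x + fst c) - snd c"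
        using t by (simp add: field_simps)
    qed
    then show ?thesis using t by (simp add: field_simps)
  qed
  have zero: "tighten p C 0 = 0"
  proof (rule antisym)
    show "tighten p C 0 \<le> 0"
      using tighten_le[OF p C, of "(0,0)" 0] C by (simp add: compatible_cone_def sublinear_0[OF p])
    show "0 \<le> tighten p C 0"
      using C by (intro le_tighten[OF C]) (auto simp: compatible_cone_def)
  qed
  have eq: "tighten p C (t *\<^sub>R x) = t * tighten p C x" if t: "t > 0" for t x
  proof (rule antisym)
    show "tighten p C (t *\<^sub>R x) \<le> t * tighten p C x" by (rule le[OF t])
    have "tighten p C (inverse t *\<^sub>R t *\<^sub>R x) \<le> inverse t * tighten p C (t *\<^sub>R x)"
      using t by (intro le) simp
    then show "t * tighten p C x \<le> tighten p C (t *\<^sub>R x)"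
      using t by (simp add: field_simps)
  qed
  show ?thesis
    unfolding sublinear_def using add eq zero by (metis le_less mult_zero_left scaleR_zero_left)
qed

lemma linear_le_tighten_iff:
  assumes p: "sublinear p" and C: "compatible_cone p C" and f: "linear f"
  shows "f \<le> tighten p C \<longleftrightarrow> f \<le> p \<and> (\<forall>c\<in>C. snd c \<le> f (fst c))"
proof (intro iffI conjI ballI)
  assume le: "f \<le> tighten p C"
  then show "f \<le> p" using tighten_le_self[OF p C] by (rule order_trans)
  fix c assume "c \<in> C"
  then have "f (- fst c) \<le> p (- fst c + fst c) - snd c"
    using le tighten_le[OF p C] by (meson le_funD order_trans)
  then show "snd c \<le> f (fst c)"
    by (simp add: sublinear_0[OF p] linear_neg[OF f])
next
  assume *: "f \<le> p \<and> (\<forall>c\<in>C. snd c \<le> f (fst c))"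
  show "f \<le> tighten p C"
  proof (rule le_funI, rule le_tighten[OF C])
    fix v c assume "c \<in> C"
    then have "snd c \<le> f (fst c)" "f (v + fst c) \<le> p (v + fst c)"
      using * by (auto simp: le_fun_def)
    then show "f v \<le> p (v + fst c) - snd c"
      by (simp add: linear_add[OF f])
  qed
qed

text \<open>
  The linear minorants of \<open>q\<close> form a face of the convex set of linear minorants of \<open>p\<close>.
\<close>

definition minorant_face :: "('a::real_vector \<Rightarrow> real) \<Rightarrow> ('a \<Rightarrow> real) \<Rightarrow> bool"
  where "minorant_face p q \<longleftrightarrow> (\<forall>f g u. linear f \<longrightarrow> linear g \<longrightarrow> f \<le> p \<longrightarrow> g \<le> p \<longrightarrow>
    0 < u \<longrightarrow> u < 1 \<longrightarrow> (\<lambda>v. (1 - u) * f v + u * g v) \<le> q \<longrightarrow> f \<le> q \<and> g \<le> q)"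

lemma minorant_faceD:
  assumes "minorant_face p q" "linear f" "linear g" "f \<le> p" "g \<le> p" "0 < u" "u < 1"
    "(\<lambda>v. (1 - u) * f v + u * g v) \<le> q"
  shows "f \<le> q" "g \<le> q"
  using assms unfolding minorant_face_def by blast+

lemma minorant_face_refl: "minorant_face p p"
  by (simp add: minorant_face_def)

lemma linear_convex_combination:
  fixes f g :: "'a::real_vector \<Rightarrow> real"
  shows "linear f \<Longrightarrow> linear g \<Longrightarrow> linear (\<lambda>v. (1 - u) * f v + u * g v)"
  by (auto simp: linear_iff algebra_simps)

lemma compatible_cone_ray:
  assumes "sublinear q"
  shows "compatible_cone q {(t *\<^sub>R x, t * q x) | t. 0 \<le> t}"
proof -
  have "\<exists>t'. t *\<^sub>R x + t'' *\<^sub>R x = t' *\<^sub>R x \<and> t * q x + t'' * q x = t' * q x \<and> 0 \<le> t'"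
    if "0 \<le> t" "0 \<le> t''" for t t''
    using that by (intro exI[of _ "t + t''"]) (simp add: algebra_simps)
  moreover have "\<exists>t'. s *\<^sub>R t *\<^sub>R x = t' *\<^sub>R x \<and> s * (t * q x) = t' * q x \<and> 0 \<le> t'"
    if "0 < s" "0 \<le> t" for s t
    using that by (intro exI[of _ "s * t"]) simp
  ultimately show ?thesis
    using assms by (auto simp: compatible_cone_def sublinear_scaleR intro: exI[of _ 0])
qed

text \<open>
  Tightening along a ray exposes the minorants that touch \<open>q\<close> at \<open>x\<close>. Where a linear functional is
  maximal over a convex set the maximisers form a face, and a face of a face is a face.
\<close>

lemma minorant_face_tighten_ray:
  assumes q: "sublinear q" "q \<le> p" and face: "minorant_face p q"
  shows "minorant_face p (tighten q {(t *\<^sub>R x, t * q x) | t. 0 \<le> t})" (is "minorant_face p (tighten q ?C)")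
  unfolding minorant_face_def
proof (intro allI impI)
  fix f g :: "'a \<Rightarrow> real" and u :: real
  assume lin: "linear f" "linear g" and le: "f \<le> p" "g \<le> p" and u: "0 < u" "u < 1"
    and m: "(\<lambda>v. (1 - u) * f v + u * g v) \<le> tighten q ?C"
  note C = compatible_cone_ray[OF q(1), of x]
  have *: "(\<lambda>v. (1 - u) * f v + u * g v) \<le> q"
    and **: "\<forall>c\<in>?C. snd c \<le> (1 - u) * f (fst c) + u * g (fst c)"
    using m unfolding linear_le_tighten_iff[OF q(1) C linear_convex_combination[OF lin]] by auto
  have fq: "f \<le> q" and gq: "g \<le> q"
    using minorant_faceD[OF face lin le u *] by auto
  have "q x \<le> (1 - u) * f x + u * g x"
    using **[rule_format, of "(1 *\<^sub>R x, 1 * q x)"] by fastforce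
  moreover have fx: "f x \<le> q x" and gx: "g x \<le> q x" using fq gq by (auto simp: le_fun_def)
  moreover have "(1 - u) * f x + u * g x \<le> (1 - u) * q x + u * g x"
    "(1 - u) * f x + u * g x \<le> (1 - u) * f x + u * q x"
    using u fx gx by (auto intro: mult_left_mono)
  ultimately have "u * q x \<le> u * g x" "(1 - u) * q x \<le> (1 - u) * f x" 
    by (auto simp: algebra_simps)
  then have "q x \<le> g x" "q x \<le> f x" using u by auto
  then have "\<forall>c\<in>?C. snd c \<le> f (fst c)" "\<forall>c\<in>?C. snd c \<le> g (fst c)"
    using lin by (auto simp: linear_scale mult_left_mono)
  with fq gq show "f \<le> tighten q ?C \<and> g \<le> tighten q ?C"
    by (simp add: linear_le_tighten_iff[OF q(1) C] lin)
qed

text \<open>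
  If tightening along the ray through \<open>x\<close> changes nothing then \<open>q (- x) \<le> - q x\<close>, so \<open>q\<close> is odd, and an odd
  sublinear functional is linear.
\<close>

lemma sublinear_minimal_imp_linear:
  assumes q: "sublinear q" and min: "\<And>x. tighten q {(t *\<^sub>R x, t * q x) | t. 0 \<le> t} = q"
  shows "linear q"
proof -
  have neg: "q (- x) = - q x" for x
  proof -
    have "tighten q {(t *\<^sub>R x, t * q x) | t. 0 \<le> t} (- x) \<le> q (- x + fst (x, q x)) - snd (x, q x)"
      by (rule tighten_le[OF q compatible_cone_ray[OF q]]) (auto intro: exI[of _ 1])
    then have "q (- x) \<le> - q x" by (simp add: min sublinear_0[OF q])
    then show ?thesis using sublinear_ge[OF q, of x] by simp
  qed
  have "q (x + y) = q x + q y" for x y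
    using sublinear_add[OF q, of x y] sublinear_add[OF q, of "x + y" "- y"] neg[of y] by simp
  moreover have "q (t *\<^sub>R x) = t * q x" for t x
    using sublinear_scaleR[OF q, of t x] sublinear_scaleR[OF q, of "- t" x] neg[of "t *\<^sub>R x"]
    by (cases "0 \<le> t") auto
  ultimately show ?thesis by (simp add: linear_iff)
qed

lemma sublinear_chain_Inf:
  assumes p: "sublinear p" and C: "C \<noteq> {}" "\<forall>q\<in>C. sublinear q \<and> q \<le> p"
    and chain: "\<forall>q\<in>C. \<forall>r\<in>C. q \<le> r \<or> r \<le> q"
  defines "m \<equiv> \<lambda>v. INF q\<in>C. q v"
  shows "sublinear m" and "\<And>q. q \<in> C \<Longrightarrow> m \<le> q" and "\<And>f. (\<And>q. q \<in> C \<Longrightarrow> f \<le> q) \<Longrightarrow> f \<le> m"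
proof -
  have m_apply: "m v = (INF q\<in>C. q v)" for v by (simp add: m_def)
  have "- p (- v) \<le> q v" if "q \<in> C" for q v
    using sublinear_ge[of q v] C(2) that by (smt (verit) le_funD)
  then have bdd: "bdd_below ((\<lambda>q. q v) ` C)" for v by (intro bdd_belowI2)
  show lower: "m \<le> q" if "q \<in> C" for q
    unfolding m_def by (rule le_funI) (rule cINF_lower[OF bdd that])
  show greatest: "f \<le> m" if "\<And>q. q \<in> C \<Longrightarrow> f \<le> q" for f
    unfolding m_def using that C(1) by (intro le_funI cINF_greatest) (auto simp: le_fun_def)
  have add: "m (x + y) \<le> m x + m y" for x y
  proof -
    have *: "m (x + y) \<le> q x + r y" if qr: "q \<in> C" "r \<in> C" for q r
    proof -
      from chain qr obtain s where s: "s \<in> C" "s \<le> q" "s \<le> r" by blast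
      have "m (x + y) \<le> s (x + y)" using lower[OF s(1)] by (simp add: le_fun_def)
      also have "\<dots> \<le> s x + s y" using C(2) s(1) by (blast intro: sublinear_add)
      also have "\<dots> \<le> q x + r y" using s by (intro add_mono) (auto simp: le_fun_def)
      finally show ?thesis .
    qed
    have "m (x + y) - r y \<le> m x" if "r \<in> C" for r
      unfolding m_apply[of x]
      using * that C(1) by (intro cINF_greatest) (auto simp: algebra_simps)
    then have "m (x + y) - m x \<le> m y"
      unfolding m_apply[of y]
      using C(1) by (intro cINF_greatest) (auto simp: algebra_simps)
    then show ?thesis by simp
  qed
  have scale: "m (t *\<^sub>R x) = t * m x" if t: "t \<ge> 0" for t x
  proof -
    have "m (t *\<^sub>R x) = (INF q\<in>C. t * q x)"
      unfolding m_def using C(2) t by (intro INF_cong) (auto simp: sublinear_scaleR)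
    also have "\<dots> = t * m x"
    proof (cases "t = 0")
      case False
      then have "mono (\<lambda>r::real. t * r)" "continuous (at_right (m x)) (\<lambda>r::real. t * r)"
        using t by (auto intro!: monoI mult_left_mono continuous_intros)
      from continuous_at_Inf_mono[OF this(1)[THEN mono_imp_mono_on] _ _ bdd[of x]] this(2) C(1)
      show ?thesis by (simp add: m_def image_image)
    qed (use C(1) in simp)
    finally show ?thesis .
  qed
  show "sublinear m" using add scale by (simp add: sublinear_def)
qed

text \<open>
  Krein-Milman and Hahn-Banach in one: \<open>e\<close> being linear, it is the only linear minorant of itself, so
  \<open>minorant_face p e\<close> says that \<open>e\<close> is an extreme point of the set of linear minorants of \<open>p\<close>.
  Faces survive infima of chains, so Zorn's lemma gives a minimal one, which no ray can tighten.
\<close>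

theorem extreme_linear_minorant:
  assumes p: "sublinear p" and q: "sublinear q" "q \<le> p" "minorant_face p q"
  obtains e where "linear e" "e \<le> q" "minorant_face p e"
proof -
  define A where "A = {r. sublinear r \<and> r \<le> q \<and> minorant_face p r}"
  have po: "partial_order_on A (relation_of (\<lambda>r s. s \<le> r) A)"
    by (rule partial_order_on_relation_ofI) auto
  have "\<exists>m\<in>A. \<forall>a\<in>A. a \<le> m \<longrightarrow> a = m"
  proof (rule predicate_Zorn[OF po])
    fix C assume "C \<in> Chains (relation_of (\<lambda>r s. s \<le> r) A)"
    then have CA: "C \<subseteq> A" and chain: "\<forall>r\<in>C. \<forall>s\<in>C. r \<le> s \<or> s \<le> r"
      by (auto simp: Chains_def relation_of_def)
    show "\<exists>u\<in>A. \<forall>a\<in>C. u \<le> a"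
    proof (cases "C = {}")
      case True
      then show ?thesis using q by (auto simp: A_def)
    next
      case False
      define m where "m = (\<lambda>v. INF r\<in>C. r v)"
      have Csq: "\<forall>r\<in>C. sublinear r \<and> r \<le> q" using CA by (auto simp: A_def)
      have Cf: "minorant_face p r" if "r \<in> C" for r using that CA by (auto simp: A_def)
      note inf = sublinear_chain_Inf[OF q(1) False Csq chain, folded m_def]
      have "m \<le> q" using False inf(2) Csq by (meson ex_in_conv order_trans)
      moreover have "minorant_face p m"
        unfolding minorant_face_def
      proof (intro allI impI)
        fix f g :: "'a \<Rightarrow> real" and u :: real
        assume *: "linear f" "linear g" "f \<le> p" "g \<le> p" "0 < u" "u < 1"
          "(\<lambda>v. (1 - u) * f v + u * g v) \<le> m"
        have "f \<le> r \<and> g \<le> r" if "r \<in> C" for r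
          using minorant_faceD[OF Cf[OF that] *(1-6) order_trans[OF *(7) inf(2)[OF that]]] by auto
        then show "f \<le> m \<and> g \<le> m" using inf(3) by blast
      qed
      ultimately have "m \<in> A" using inf(1) by (simp add: A_def)
      then show ?thesis using inf(2) by auto
    qed
  qed
  then obtain m where m: "m \<in> A" and min: "\<And>a. a \<in> A \<Longrightarrow> a \<le> m \<Longrightarrow> a = m" by auto
  have mq: "sublinear m" "m \<le> q" "minorant_face p m" using m by (auto simp: A_def)
  have "linear m"
  proof (rule sublinear_minimal_imp_linear[OF mq(1)])
    fix x
    note C = compatible_cone_ray[OF mq(1), of x]
    have le: "tighten m {(t *\<^sub>R x, t * m x) | t. 0 \<le> t} \<le> m"
      by (rule tighten_le_self[OF mq(1) C])
    moreover have "tighten m {(t *\<^sub>R x, t * m x) | t. 0 \<le> t} \<in> A"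
      unfolding A_def
      using sublinear_tighten[OF mq(1) C] order_trans[OF le mq(2)]
        minorant_face_tighten_ray[OF mq(1) order_trans[OF mq(2) q(2)] mq(3)] by simp
    ultimately show "tighten m {(t *\<^sub>R x, t * m x) | t. 0 \<le> t} = m" by (rule min[rotated])
  qed
  then show ?thesis using that mq by blast
qed

text \<open>
  The Mazur-Orlicz form of the Hahn-Banach theorem.
\<close>

corollary sandwich:
  assumes p: "sublinear p" and C: "compatible_cone p C"
  obtains f where "linear f" "f \<le> p" "\<And>c. c \<in> C \<Longrightarrow> snd c \<le> f (fst c)"
proof -
  note t = sublinear_tighten[OF p C]
  obtain f where f: "linear f" "f \<le> tighten p C"
    using extreme_linear_minorant[OF t t order_refl minorant_face_refl] by auto
  then show ?thesis using that linear_le_tighten_iff[OF p C f(1)] by blast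
qed

section \<open>Real and complex scalars\<close>

text \<open>
  A choice of the embedding of the scalars into the complex numbers. It serves to define real parts and to
  use compactness of bounded closed sets of scalars.
\<close>

definition to_complex :: "'k::real_or_complex \<Rightarrow> complex"
  where "to_complex = (SOME \<phi>. (\<forall>x y. \<phi> (x + y) = \<phi> x + \<phi> y) \<and> (\<forall>r x. \<phi> (r *\<^sub>R x) = r *\<^sub>R \<phi> x)
       \<and> (\<forall>x y. \<phi> (x * y) = \<phi> x * \<phi> y) \<and> (\<forall>x. norm (\<phi> x) = norm x)
       \<and> (range \<phi> = \<real> \<or> range \<phi> = UNIV))"

lemma to_complex_properties:
  fixes c d :: "'k::real_or_complex"
  shows to_complex_add: "to_complex (c + d) = to_complex c + to_complex d"
    and to_complex_scaleR: "to_complex (r *\<^sub>R c) = r *\<^sub>R to_complex c"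
    and to_complex_mult: "to_complex (c * d) = to_complex c * to_complex d"
    and norm_to_complex: "norm (to_complex c) = norm c"
    and range_to_complex: "range (to_complex :: 'k \<Rightarrow> complex) = \<real> \<or> range (to_complex :: 'k \<Rightarrow> complex) = UNIV"
  using someI_ex[OF iso_real_or_complex[where 'a = 'k], folded to_complex_def] by blast+

lemma bounded_linear_to_complex: "bounded_linear (to_complex :: 'k::real_or_complex \<Rightarrow> complex)"
  by (rule bounded_linear_intro[where K = 1])
    (simp_all add: to_complex_add to_complex_scaleR norm_to_complex)

lemma to_complex_1: "to_complex (1 :: 'k::real_or_complex) = 1"
proof -
  have "to_complex (1 :: 'k) * to_complex (1 :: 'k) = to_complex (1 :: 'k)"
    by (simp flip: to_complex_mult)
  moreover have "to_complex (1 :: 'k) \<noteq> 0"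
    using norm_to_complex[of "1 :: 'k"] by auto
  ultimately show ?thesis by simp
qed

lemma to_complex_of_real: "to_complex (of_real r :: 'k::real_or_complex) = of_real r"
  by (simp add: of_real_def to_complex_scaleR to_complex_1)

lemma to_complex_diff: "to_complex (c - d :: 'k::real_or_complex) = to_complex c - to_complex d"
  by (rule linear_diff[OF bounded_linear.linear[OF bounded_linear_to_complex]])

lemma inj_to_complex: "to_complex c = to_complex d \<Longrightarrow> c = (d :: 'k::real_or_complex)"
  using norm_to_complex[of "c - d"] by (simp add: to_complex_diff)

definition re_part :: "'k::real_or_complex \<Rightarrow> real"
  where "re_part c = Re (to_complex c)"

lemma bounded_linear_re_part: "bounded_linear (re_part :: 'k::real_or_complex \<Rightarrow> real)"
  unfolding re_part_def
  by (rule bounded_linear_compose[OF bounded_linear_Re bounded_linear_to_complex])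

lemmas linear_re_part = bounded_linear.linear[OF bounded_linear_re_part]

lemma re_part_of_real: "re_part (of_real r :: 'k::real_or_complex) = r"
  by (simp add: re_part_def to_complex_of_real)

lemma re_part_le_norm: "re_part c \<le> norm c"
  using complex_Re_le_cmod[of "to_complex c"] by (simp add: re_part_def norm_to_complex)

lemma eq_of_real_if_re_part_ge:
  fixes c :: "'k::real_or_complex"
  assumes "norm c \<le> r" "r \<le> re_part c"
  shows "c = of_real r"
proof (rule inj_to_complex)
  let ?z = "to_complex c"
  have "Re ?z = r" "cmod ?z = r"
    using assms complex_Re_le_cmod[of ?z] by (auto simp: re_part_def norm_to_complex)
  then have "Im ?z = 0" using cmod_power2[of ?z] by simp
  with \<open>Re ?z = r\<close> show "?z = to_complex (of_real r :: 'k)"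
    by (simp add: to_complex_of_real complex_eq_iff)
qed

lemma exists_rotation:
  fixes c :: "'k::real_or_complex"
  obtains u where "norm u = 1" "u * c = of_real (norm c)"
proof (cases "c = 0")
  case True
  then show ?thesis using that[of 1] by simp
next
  case False
  then show ?thesis using that[of "of_real (norm c) / c"] by (simp add: norm_divide)
qed

lemma ops_iff: "T \<in> ops sX sY \<longleftrightarrow> (\<forall>c x. T (sX c x) = sY c (T x))"
  using norm_blinfun by (auto simp: ops_def bounded_ops_def blinfun.add_right)

lemma dual_iff: "f \<in> dual sY \<longleftrightarrow> (\<forall>c y. f (sY c y) = c * f y)"
  by (simp add: dual_def ops_iff)

context banach_over
begin

lemma scale_scaleR: "scale (r *\<^sub>R c) y = r *\<^sub>R scale c y"
  by (simp add: scaleR_conv_of_real scale_of_real flip: scale_scale)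

lemma scaleR_scale: "scale c (r *\<^sub>R y) = r *\<^sub>R scale c y"
  by (metis scale_of_real scale_left_commute)

lemma bounded_bilinear_scale: "bounded_bilinear scale"
  by (rule bounded_bilinear.intro)
    (auto simp: scale_left_distrib scale_right_distrib scale_scaleR scaleR_scale norm_scale intro: exI[of _ 1])

lemma linear_re_dual: "linear (\<lambda>y. re_part (blinfun_apply f y))"
  using linear_compose[OF bounded_linear.linear[OF blinfun.bounded_linear_right] linear_re_part] by (simp add: o_def)

lemma dual_eqI:
  assumes f: "f \<in> dual scale" and g: "g \<in> dual scale" and eq: "\<And>y. re_part (f y) = re_part (g y)"
  shows "f = g"
proof (rule blinfun_eqI)
  fix y
  obtain u where u: "norm u = 1" "u * (f y - g y) = of_real (norm (f y - g y))"
    by (rule exists_rotation)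
  have "of_real (norm (f y - g y)) = f (scale u y) - g (scale u y)"
    using u f g by (simp add: dual_iff algebra_simps)
  then have "norm (f y - g y) = re_part (f (scale u y)) - re_part (g (scale u y))"
    by (metis linear_diff[OF linear_re_part] re_part_of_real)
  then show "f y = g y" by (simp add: eq)
qed

lemma norm_dual_le:
  assumes f: "f \<in> dual scale" and le: "\<And>y. re_part (f y) \<le> B * norm y"
  shows "norm (f y) \<le> B * norm y"
proof -
  obtain u where u: "norm u = 1" "u * f y = of_real (norm (f y))" by (rule exists_rotation)
  have "norm (f y) = re_part (f (scale u y))"
    using u f by (simp add: dual_iff re_part_of_real)
  also have "\<dots> \<le> B * norm y" using le[of "scale u y"] by (simp add: norm_scale u)
  finally show ?thesis .
qed

section \<open>Extreme functionals of the dual ball\<close>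

text \<open>
  Over the complex numbers this is the formula \<open>f y = g y - \<i> g (\<i> y)\<close>; over the reals \<open>f = g\<close>. Rotating
  \<open>f y\<close> onto the positive axis shows that no norm is lost.
\<close>

theorem complexify:
  assumes g: "linear g" and B: "0 \<le> B" and le: "\<And>y. g y \<le> B * norm y"
  obtains f :: "'a \<Rightarrow>\<^sub>L 'k" where "f \<in> dual scale" "\<And>y. re_part (f y) = g y" "norm f \<le> B"
proof -
  have "- g y \<le> B * norm y" for y using le[of "- y"] by (simp add: linear_neg[OF g])
  with le have abs: "\<bar>g y\<bar> \<le> B * norm y" for y by (simp add: abs_le_iff)
  have blg: "bounded_linear g"
    using g abs
    by (intro bounded_linear_intro[where K = B]) (auto simp: linear_add linear_scale mult.commute)
  have "\<exists>F :: 'a \<Rightarrow> 'k. bounded_linear F \<and> (\<forall>c y. F (scale c y) = c * F y) \<and> (\<forall>y. re_part (F y) = g y)"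
  proof (cases "range (to_complex :: 'k \<Rightarrow> complex) = \<real>")
    case True
    have c: "c = of_real (re_part c)" for c :: 'k
    proof (rule inj_to_complex)
      have "to_complex c \<in> \<real>" using True by blast
      then show "to_complex c = to_complex (of_real (re_part c) :: 'k)"
        by (auto simp: to_complex_of_real re_part_def elim!: Reals_cases)
    qed
    have "of_real (g (scale c y)) = c * of_real (g y)" for c :: 'k and y
      by (subst (1 2) c) (simp add: scale_of_real linear_scale[OF g])
    moreover have "bounded_linear (\<lambda>y. of_real (g y) :: 'k)"
      by (rule bounded_linear_compose[OF bounded_linear_of_real blg])
    ultimately show ?thesis by (intro exI[of _ "\<lambda>y. of_real (g y)"]) (simp add: re_part_of_real)
  next
    case False
    then have ran: "range (to_complex :: 'k \<Rightarrow> complex) = UNIV" using range_to_complex by blast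
    then obtain i :: 'k where i: "to_complex i = \<i>" by (metis UNIV_I imageE)
    have ii: "i * i = - 1"
      by (rule inj_to_complex)
        (simp add: to_complex_mult i to_complex_1 linear_neg[OF bounded_linear.linear[OF bounded_linear_to_complex]])
    define F where "F y = (of_real (g y) :: 'k) - i * of_real (g (scale i y))" for y
    have Fi: "F (scale i y) = i * F y" for y
    proof -
      have "scale i (scale i y) = - y" by (simp add: ii)
      then have "F (scale i y) = of_real (g (scale i y)) + i * of_real (g y)"
        by (simp add: F_def linear_neg[OF g])
      also have "\<dots> = i * of_real (g y) - (i * i) * of_real (g (scale i y))" by (simp add: ii)
      also have "\<dots> = i * F y" by (simp add: F_def algebra_simps)
      finally show ?thesis .
    qed
    have bl: "bounded_linear F"
      unfolding F_def
      by (intro bounded_linear_sub bounded_linear_const_mult bounded_linear_compose[OF bounded_linear_of_real]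
          bounded_linear_compose[OF blg] blg bounded_bilinear.bounded_linear_right[OF bounded_bilinear_scale])
    have "F (scale c y) = c * F y" for c y
    proof -
      have "c = of_real (Re (to_complex c)) + of_real (Im (to_complex c)) * i"
        by (rule inj_to_complex)
          (simp add: to_complex_add to_complex_mult to_complex_of_real i complex_eq_iff)
      then obtain a b where c: "c = of_real a + of_real b * i" by blast
      have "scale c y = a *\<^sub>R y + b *\<^sub>R scale i y"
        by (simp add: c scale_left_distrib scale_of_real flip: scale_scale)
      then have "F (scale c y) = a *\<^sub>R F y + b *\<^sub>R F (scale i y)"
        using bounded_linear.linear[OF bl] by (simp add: linear_add linear_scale)
      then show ?thesis by (simp add: Fi c scaleR_conv_of_real algebra_simps)
    qed
    moreover have "re_part (F y) = g y" for y
      by (simp add: F_def re_part_def to_complex_diff to_complex_mult i to_complex_of_real)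
    ultimately show ?thesis using bl by blast
  qed
  then obtain F :: "'a \<Rightarrow> 'k" where F: "bounded_linear F" "\<And>c y. F (scale c y) = c * F y"
    "\<And>y. re_part (F y) = g y" by blast
  define f where "f = Blinfun F"
  have f: "blinfun_apply f = F" by (simp add: f_def bounded_linear_Blinfun_apply F(1))
  have fd: "f \<in> dual scale" by (simp add: dual_iff f F(2))
  have "norm (f y) \<le> B * norm y" for y
    using norm_dual_le[OF fd] le by (simp add: f F(3))
  then have "norm f \<le> B" by (rule norm_blinfun_bound[OF B])
  then show ?thesis using that fd F(3) by (simp add: f)
qed

lemma dual_unit_ball_le:
  assumes "f \<in> dual scale \<inter> cball 0 1"
  shows "norm (blinfun_apply f y) \<le> norm y" "re_part (blinfun_apply f y) \<le> norm y"
proof -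
  have "norm (f y) \<le> norm f * norm y" by (rule norm_blinfun)
  also have "\<dots> \<le> 1 * norm y" using assms by (intro mult_right_mono) auto
  finally show "norm (f y) \<le> norm y" by simp
  then show "re_part (f y) \<le> norm y" using re_part_le_norm[of "f y"] by simp
qed

text \<open>
  Taking real parts identifies the dual ball with the set of real-linear minorants of the norm, as convex
  sets. Extreme linear minorants therefore yield extreme points of the dual ball.
\<close>

theorem extreme_dual_functional:
  assumes q: "sublinear q" "q \<le> norm" "minorant_face norm q"
  obtains e :: "'a \<Rightarrow>\<^sub>L 'k" where "e extreme_point_of (dual scale \<inter> cball 0 1)" "\<And>y. re_part (e y) \<le> q y"
proof -
  have n: "sublinear (norm :: 'a \<Rightarrow> real)" using sublinear_norm[of 1, where 'a = 'a] by simp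
  obtain r where r: "linear r" "r \<le> q" "minorant_face norm r"
    using extreme_linear_minorant[OF n q] .
  have rn: "r y \<le> 1 * norm y" for y using order_trans[OF r(2) q(2)] by (simp add: le_fun_def)
  obtain e :: "'a \<Rightarrow>\<^sub>L 'k" where e: "e \<in> dual scale" "\<And>y. re_part (e y) = r y" "norm e \<le> 1"
    using complexify[OF r(1) _ rn] by auto
  have minorant: "(\<lambda>y. re_part (blinfun_apply a y)) \<le> norm" if "a \<in> dual scale \<inter> cball 0 1" for a :: "'a \<Rightarrow>\<^sub>L 'k"
    using dual_unit_ball_le(2)[OF that] by (simp add: le_fun_def)
  have eq: "a = e" if a: "a \<in> dual scale \<inter> cball 0 1" "(\<lambda>y. re_part (blinfun_apply a y)) \<le> r" for a :: "'a \<Rightarrow>\<^sub>L 'k"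
  proof (rule dual_eqI)
    fix y
    have "re_part (a y) \<le> r y" "re_part (a (- y)) \<le> r (- y)" using a(2) by (auto simp: le_fun_def)
    then show "re_part (a y) = re_part (e y)"
      by (simp add: e(2) linear_neg[OF r(1)] linear_neg[OF linear_re_dual])
  qed (use a e in auto)
  have "e extreme_point_of (dual scale \<inter> cball 0 1)"
    unfolding extreme_point_of_def
  proof (intro conjI ballI notI)
    show "e \<in> dual scale \<inter> cball 0 1" using e by simp
    fix a b :: "'a \<Rightarrow>\<^sub>L 'k"
    assume ab: "a \<in> dual scale \<inter> cball 0 1" "b \<in> dual scale \<inter> cball 0 1" and "e \<in> open_segment a b"
    then obtain u where u: "0 < u" "u < 1" "e = (1 - u) *\<^sub>R a + u *\<^sub>R b" and neq: "a \<noteq> b"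
      by (auto simp: in_segment)
    have "(1 - u) * re_part (a y) + u * re_part (b y) \<le> r y" for y
      by (simp add: u(3) blinfun.add_left blinfun.scaleR_left linear_add[OF linear_re_part]
          linear_scale[OF linear_re_part] flip: e(2))
    then have "(\<lambda>y. (1 - u) * re_part (a y) + u * re_part (b y)) \<le> r" by (simp add: le_fun_def)
    from minorant_faceD[OF r(3) linear_re_dual linear_re_dual minorant[OF ab(1)] minorant[OF ab(2)] u(1,2) this]
    have "a = e" "b = e" using eq ab by blast+
    with neq show False by simp
  qed
  then show ?thesis using that e(2) r(2) by (simp add: le_fun_def)
qed

text \<open>
  The face of functionals that attain the norm at \<open>y\<close> is obtained by tightening the norm along the ray through \<open>y\<close>.
\<close>

corollary extreme_norming_functional:
  obtains e :: "'a \<Rightarrow>\<^sub>L 'k" where "e extreme_point_of (dual scale \<inter> cball 0 1)" "e y = of_real (norm y)"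
proof -
  have n: "sublinear (norm :: 'a \<Rightarrow> real)" using sublinear_norm[of 1, where 'a = 'a] by simp
  note C = compatible_cone_ray[OF n, of y]
  obtain e :: "'a \<Rightarrow>\<^sub>L 'k" where e: "e extreme_point_of (dual scale \<inter> cball 0 1)"
    "\<And>v. re_part (e v) \<le> tighten norm {(t *\<^sub>R y, t * norm y) | t. 0 \<le> t} v"
    using extreme_dual_functional[OF sublinear_tighten[OF n C] tighten_le_self[OF n C]
        minorant_face_tighten_ray[OF n order_refl minorant_face_refl]] by blast
  have ed: "e \<in> dual scale \<inter> cball 0 1" using e(1) by (simp add: extreme_point_of_def)
  have "(\<lambda>v. re_part (e v)) \<le> tighten norm {(t *\<^sub>R y, t * norm y) | t. 0 \<le> t}"
    using e(2) by (simp add: le_fun_def)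
  then have "\<forall>c\<in>{(t *\<^sub>R y, t * norm y) | t. 0 \<le> t}. snd c \<le> re_part (e (fst c))"
    using linear_le_tighten_iff[OF n C linear_re_dual] by blast
  from bspec[OF this, of "(1 *\<^sub>R y, 1 * norm y)"] have ge: "norm y \<le> re_part (e y)" by fastforce
  with dual_unit_ball_le(1)[OF ed, of y] have "e y = of_real (norm y)"
    using eq_of_real_if_re_part_ge by blast
  then show ?thesis using that e(1) by blast
qed

text \<open>
  Let \<open>F f\<close> be the sum of the nonnegative terms \<open>1 - re_part (f (w k))\<close>, an affine functional on the dual
  ball with values up to infinity. By Hahn-Banach its minimum is \<open>m\<close>, the supremum of
  \<open>K - norm (w 0 + \<dots> + w (K - 1))\<close>, which the hypothesis bounds. The minimisers of an affine functional form a face, so some extreme point \<open>e\<close> has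
  \<open>F e \<le> m\<close>. The terms of a convergent series tend to \<open>0\<close>.
\<close>

theorem extreme_functional_along_sequence:
  fixes w :: "nat \<Rightarrow> 'a"
  assumes w: "\<And>k. norm (w k) \<le> 1" and c: "\<And>K. real K - norm (\<Sum>k<K. w k) \<le> c"
  obtains e :: "'a \<Rightarrow>\<^sub>L 'k" where "e extreme_point_of (dual scale \<inter> cball 0 1)"
    "\<And>\<delta>. \<delta> > 0 \<Longrightarrow> \<exists>k. re_part (e (w k)) > 1 - \<delta>"
proof -
  define s where "s K = (\<Sum>k<K. w k)" for K
  define m where "m = (SUP K. real K - norm (s K))"
  have bdd: "bdd_above (range (\<lambda>K. real K - norm (s K)))"
    using c by (intro bdd_aboveI2) (auto simp: s_def)
  have m: "real K - norm (s K) \<le> m" for K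
    unfolding m_def by (rule cSUP_upper[OF _ bdd]) simp
  have diff: "norm (s L - s K) \<le> real L - real K" if "K \<le> L" for K L
  proof -
    have "s L - s K = sum w {K..<L}"
      using that by (simp add: s_def lessThan_atLeast0 sum_diff_nat_ivl)
    also have "norm \<dots> \<le> real (card {K..<L}) * 1"
      using w by (intro sum_norm_bound) auto
    finally show ?thesis using that by (simp add: of_nat_diff)
  qed
  \<comment> \<open>Encodes \<open>F f \<le> m\<close>. The error terms \<open>u\<close> make the
      set closed under addition, as they absorb the difference of two partial sums.\<close>
  define C where "C = {(t *\<^sub>R s K + u, a) | t K u a. 0 \<le> t \<and> a \<le> t * (real K - m) - norm u}"
  have C_I: "(v, a) \<in> C" if "v = t *\<^sub>R s K + u" "0 \<le> t" "a \<le> t * (real K - m) - norm u" for v a t K u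
    unfolding C_def using that by blast
  have C_E: "\<exists>t K u. v = t *\<^sub>R s K + u \<and> 0 \<le> t \<and> a \<le> t * (real K - m) - norm u" if "(v, a) \<in> C" for v a
    using that unfolding C_def by blast
  have n: "sublinear (norm :: 'a \<Rightarrow> real)" using sublinear_norm[of 1, where 'a = 'a] by simp
  have C_add: "(v + v', a + a') \<in> C"
    if v: "v = t *\<^sub>R s K + u" "0 \<le> t" "a \<le> t * (real K - m) - norm u"
      and v': "v' = t' *\<^sub>R s L + u'" "0 \<le> t'" "a' \<le> t' * (real L - m) - norm u'"
      and KL: "K \<le> L" for v v' a a' t t' K L u u'
  proof (rule C_I)
    let ?u = "u + u' - t *\<^sub>R (s L - s K)"
    show "v + v' = (t + t') *\<^sub>R s L + ?u" by (simp add: v(1) v'(1) algebra_simps)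
    have "norm ?u \<le> norm (u + u') + norm (t *\<^sub>R (s L - s K))" by (rule norm_triangle_ineq4)
    also have "\<dots> \<le> (norm u + norm u') + t * (real L - real K)"
      using v(2) by (auto intro!: add_mono norm_triangle_ineq mult_left_mono diff[OF KL])
    finally show "a + a' \<le> (t + t') * (real L - m) - norm ?u"
      using v(3) v'(3) by (simp add: algebra_simps)
  qed (use v v' in simp)
  have C: "compatible_cone norm C"
    unfolding compatible_cone_def
  proof (intro conjI ballI allI impI)
    show "(0, 0) \<in> C" by (rule C_I[of _ 0 0 0]) auto
    fix c assume "c \<in> C"
    then obtain v a where c: "c = (v, a)" "(v, a) \<in> C" by (cases c) auto
    then obtain t K u where v: "v = t *\<^sub>R s K + u" "0 \<le> t" "a \<le> t * (real K - m) - norm u"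
      using C_E by blast
    show "snd c \<le> norm (fst c)"
    proof -
      have "t * (real K - m) \<le> t * norm (s K)" using m[of K] v(2) by (intro mult_left_mono) auto
      also have "\<dots> = norm (v - u)" using v by simp
      also have "\<dots> \<le> norm v + norm u" by (rule norm_triangle_ineq4)
      finally show ?thesis using v(3) c by simp
    qed
    show "r *\<^sub>R c \<in> C" if r: "0 < r" for r
    proof -
      have "(r *\<^sub>R v, r * a) \<in> C"
      proof (rule C_I)
        show "r *\<^sub>R v = (r * t) *\<^sub>R s K + r *\<^sub>R u" by (simp add: v(1) algebra_simps)
        have "r * a \<le> r * (t * (real K - m) - norm u)" using r v(3) by simp
        then show "r * a \<le> (r * t) * (real K - m) - norm (r *\<^sub>R u)" using r by (simp add: algebra_simps)
      qed (use r v in simp)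
      then show ?thesis by (simp add: c)
    qed
    fix d assume "d \<in> C"
    then obtain v' a' where d: "d = (v', a')" "(v', a') \<in> C" by (cases d) auto
    then obtain t' L u' where v': "v' = t' *\<^sub>R s L + u'" "0 \<le> t'" "a' \<le> t' * (real L - m) - norm u'"
      using C_E by blast
    show "c + d \<in> C"
      using C_add[OF v v'] C_add[OF v' v] by (cases "K \<le> L") (auto simp: c d add.commute)
  qed
  have minorant_iff: "f \<le> tighten norm C \<longleftrightarrow> (\<forall>K. real K - m \<le> f (s K))"
    if f: "linear f" "f \<le> norm" for f
  proof
    assume "f \<le> tighten norm C"
    then have *: "\<forall>c\<in>C. snd c \<le> f (fst c)" using linear_le_tighten_iff[OF n C f(1)] by blast
    have "(s K, real K - m) \<in> C" for K by (rule C_I[of _ 1 K 0]) auto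
    from bspec[OF * this] show "\<forall>K. real K - m \<le> f (s K)" by simp
  next
    assume *: "\<forall>K. real K - m \<le> f (s K)"
    have "a \<le> f v" if "(v, a) \<in> C" for v a
    proof -
      from C_E[OF that] obtain t K u
        where v: "v = t *\<^sub>R s K + u" "0 \<le> t" "a \<le> t * (real K - m) - norm u" by blast
      have "f (- u) \<le> norm u" using f(2) by (metis le_funD norm_minus_cancel)
      moreover have "t * (real K - m) \<le> t * f (s K)" using * v(2) by (intro mult_left_mono) auto
      ultimately show ?thesis
        using v by (simp add: linear_add[OF f(1)] linear_scale[OF f(1)] linear_neg[OF f(1)])
    qed
    then show "f \<le> tighten norm C" using linear_le_tighten_iff[OF n C f(1)] f(2) by auto
  qed
  \<comment> \<open>A deficit \<open>d\<close> of \<open>f\<close> at one \<open>K\<close> persists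
      for all larger indices, whereas \<open>g\<close> cannot make up for it beyond the gap between
      \<open>m\<close> and \<open>real L - norm (s L)\<close>, which is arbitrarily small.\<close>
  have one_side: "real K - m \<le> f (s K)"
    if f: "linear f" "f \<le> norm" and g: "g \<le> norm" and u: "0 < u" "u < 1"
      and avg: "\<forall>K. real K - m \<le> (1 - u) * f (s K) + u * g (s K)" for f g :: "'a \<Rightarrow> real" and u K
  proof (rule ccontr)
    assume "\<not> ?thesis"
    define d where "d = real K - m - f (s K)"
    with \<open>\<not> ?thesis\<close> have d: "d > 0" by simp
    with u have "(1 - u) * d / u > 0" by (intro divide_pos_pos mult_pos_pos) auto
    then have "m - (1 - u) * d / u < m" by linarith
    then obtain L0 where "m - (1 - u) * d / u < real L0 - norm (s L0)"
      unfolding m_def using less_cSUP_iff[OF _ bdd] by (metis UNIV_not_empty UNIV_I)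
    moreover define L where "L = max K L0"
    ultimately have "m - (1 - u) * d / u < real L - norm (s L)"
      using diff[of L0 L] norm_triangle_ineq2[of "s L" "s L0"] by simp
    moreover have "g (s L) \<le> norm (s L)" using g by (simp add: le_fun_def)
    moreover define a where "a = real L - m"
    ultimately have "g (s L) < a + (1 - u) * d / u" by linarith
    then have "u * g (s L) < u * (a + (1 - u) * d / u)" using u by simp
    also have "\<dots> = u * a + (1 - u) * d" using u by (simp add: distrib_left)
    finally have 1: "u * g (s L) < u * a + (1 - u) * d" .
    have "f (s L - s K) \<le> norm (s L - s K)" using f(2) by (simp add: le_fun_def)
    also have "\<dots> \<le> real L - real K" by (rule diff) (simp add: L_def)
    finally have "f (s L) \<le> a - d" by (simp add: linear_diff[OF f(1)] a_def d_def)
    then have "(1 - u) * f (s L) \<le> (1 - u) * (a - d)" using u by (intro mult_left_mono) auto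
    also have "\<dots> = a - u * a - (1 - u) * d" by (simp add: left_diff_distrib right_diff_distrib)
    finally have "(1 - u) * f (s L) + u * g (s L) < a" using 1 by linarith
    then show False using avg[rule_format, of L] by (simp add: a_def)
  qed
  have face: "minorant_face norm (tighten norm C)"
    unfolding minorant_face_def
  proof (intro allI impI)
    fix f g :: "'a \<Rightarrow> real" and u :: real
    assume f: "linear f" and g: "linear g" and fn: "f \<le> norm" and gn: "g \<le> norm" and u: "0 < u" "u < 1"
      and le: "(\<lambda>v. (1 - u) * f v + u * g v) \<le> tighten norm C"
    have "(\<lambda>v. (1 - u) * f v + u * g v) \<le> norm"
      using le tighten_le_self[OF n C] by (rule order_trans)
    with le have avg: "\<forall>K. real K - m \<le> (1 - u) * f (s K) + u * g (s K)"
      using minorant_iff[OF linear_convex_combination[OF f g]] by blast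
    then have "\<forall>K. real K - m \<le> (1 - (1 - u)) * g (s K) + (1 - u) * f (s K)" by (simp add: add.commute)
    then show "f \<le> tighten norm C \<and> g \<le> tighten norm C"
      using one_side[OF f fn gn u avg] one_side[OF g gn fn, of "1 - u"] u
      by (simp add: minorant_iff f g fn gn)
  qed
  obtain e :: "'a \<Rightarrow>\<^sub>L 'k" where e: "e extreme_point_of (dual scale \<inter> cball 0 1)"
    "\<And>y. re_part (e y) \<le> tighten norm C y"
    using extreme_dual_functional[OF sublinear_tighten[OF n C] tighten_le_self[OF n C] face] by blast
  have ge: "real K - m \<le> re_part (e (s K))" for K
  proof -
    have "(\<lambda>y. re_part (e y)) \<le> tighten norm C" using e(2) by (simp add: le_fun_def)
    moreover from this have "(\<lambda>y. re_part (e y)) \<le> norm" using tighten_le_self[OF n C] by (rule order_trans)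
    ultimately show ?thesis using minorant_iff[OF linear_re_dual] by blast
  qed
  have "\<exists>k. re_part (e (w k)) > 1 - \<delta>" if \<delta>: "\<delta> > 0" for \<delta>
  proof (rule ccontr)
    assume "\<not> ?thesis"
    then have small: "re_part (e (w k)) \<le> 1 - \<delta>" for k by (simp add: not_less)
    obtain K where K: "m < real K * \<delta>" using reals_Archimedean3[OF \<delta>] by blast
    have "re_part (e (s K)) = (\<Sum>k<K. re_part (e (w k)))"
      unfolding s_def by (rule linear_sum[OF linear_re_dual])
    also have "\<dots> \<le> real (card {..<K}) * (1 - \<delta>)" using small by (intro sum_bounded_above) auto
    finally have "re_part (e (s K)) \<le> real K * (1 - \<delta>)" by simp
    with ge[of K] K show False by (simp add: algebra_simps)
  qed
  with that e(1) show ?thesis by blast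
qed

end

section \<open>The Bishop-Phelps theorem on the range of a projection\<close>

text \<open>
  Ekeland's variational principle for a linear functional. The order \<open>\<epsilon> * norm (y - x) \<le> l y - l x\<close> has a maximal
  element: a sequence that at each step climbs almost as far as possible is Cauchy, and its limit is the
  only point above all its members.
\<close>

lemma linear_ekeland:
  fixes D :: "'a::banach set"
  assumes D: "closed D" "D \<noteq> {}" and l: "bounded_linear l" and bdd: "bdd_above (l ` D)" and \<epsilon>: "\<epsilon> > 0"
  obtains x where "x \<in> D" "\<And>y. y \<in> D \<Longrightarrow> l y \<le> l x + \<epsilon> * norm (y - x)"
proof -
  define A where "A x = {y \<in> D. \<epsilon> * norm (y - x) \<le> l y - l x}" for x
  have refl: "x \<in> A x" if "x \<in> D" for x using that by (simp add: A_def)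
  have A_trans: "z \<in> A x" if "z \<in> A y" "y \<in> A x" for x y z
  proof -
    have "\<epsilon> * norm (z - x) \<le> \<epsilon> * (norm (z - y) + norm (y - x))"
      using \<epsilon> norm_triangle_ineq[of "z - y" "y - x"] by (intro mult_left_mono) auto
    then show ?thesis using that by (auto simp: A_def algebra_simps)
  qed
  have step: "\<exists>y. y \<in> A x \<and> (\<forall>z\<in>A x. l z < l y + \<delta>)" if x: "x \<in> D" and \<delta>: "\<delta> > 0" for x \<delta>
  proof -
    have b: "bdd_above (l ` A x)" using bdd by (rule bdd_above_mono) (auto simp: A_def)
    have "(SUP z\<in>A x. l z) - \<delta> < (SUP z\<in>A x. l z)" using \<delta> by simp
    then obtain y where "y \<in> A x" "(SUP z\<in>A x. l z) - \<delta> < l y"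
      using less_cSUP_iff[OF _ b] refl[OF x] by (metis empty_iff)
    moreover have "l z \<le> (SUP z\<in>A x. l z)" if "z \<in> A x" for z by (rule cSUP_upper[OF that b])
    ultimately show ?thesis by (intro exI[of _ y]) fastforce
  qed
  have "\<exists>x. \<forall>n. x n \<in> D \<and> (x (Suc n) \<in> A (x n) \<and> (\<forall>z\<in>A (x n). l z < l (x (Suc n)) + (1/2) ^ n))"
  proof (rule dependent_nat_choice)
    show "\<exists>x. x \<in> D" using D by blast
    fix x and n :: nat assume "x \<in> D"
    from step[OF this, of "(1/2) ^ n"]
    show "\<exists>y. y \<in> D \<and> y \<in> A x \<and> (\<forall>z\<in>A x. l z < l y + (1/2) ^ n)" by (auto simp: A_def)
  qed
  then obtain x where *: "\<forall>n. x n \<in> D \<and> (x (Suc n) \<in> A (x n) \<and> (\<forall>z\<in>A (x n). l z < l (x (Suc n)) + (1/2) ^ n))"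
    by (rule exE)
  then have x: "\<And>n. x n \<in> D" "\<And>n. x (Suc n) \<in> A (x n)"
    and big: "\<And>n z. z \<in> A (x n) \<Longrightarrow> l z < l (x (Suc n)) + (1/2) ^ n" by auto
  have tail: "x (n + k) \<in> A (x n)" for n k
  proof (induction k)
    case 0
    from refl[OF x(1)] show ?case by (simp only: add_0_right)
  next
    case (Suc k)
    from A_trans[OF x(2) Suc] show ?case by (simp only: add_Suc_right)
  qed
  have close: "\<epsilon> * norm (z - x (Suc n)) \<le> (1/2) ^ n" if "z \<in> A (x (Suc n))" for z n
    using that big[OF A_trans[OF that x(2)]] by (simp add: A_def)
  have lim_unique: "x \<longlonglongrightarrow> z" if "\<And>n. z \<in> A (x n)" for z
  proof -
    have le: "norm (x (Suc n) - z) \<le> (1/2) ^ n / \<epsilon>" for n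
      using close[OF that, of n] \<epsilon> by (simp add: field_simps norm_minus_commute)
    have "(\<lambda>n. (1/2) ^ n / \<epsilon>) \<longlonglongrightarrow> 0"
      by (rule tendsto_divide_zero[OF LIMSEQ_power_zero]) simp
    then have "(\<lambda>n. x (Suc n) - z) \<longlonglongrightarrow> 0"
      by (rule Lim_null_comparison[OF always_eventually[OF allI[OF le]]])
    then have "(\<lambda>n. x (Suc n)) \<longlonglongrightarrow> z" by (rule LIM_zero_cancel)
    then show ?thesis by (rule LIMSEQ_imp_Suc)
  qed
  have "Cauchy x"
  proof (rule metric_CauchyI)
    fix r :: real assume r: "r > 0"
    obtain n where n: "(1/2) ^ n < \<epsilon> * r / 2" using real_arch_pow_inv[of "\<epsilon> * r / 2" "1/2"] \<epsilon> r by auto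
    have "dist (x m) (x (Suc n)) < r / 2" if "m \<ge> Suc n" for m
    proof -
      have "\<epsilon> * norm (x m - x (Suc n)) \<le> (1/2) ^ n"
        using close tail[of "Suc n" "m - Suc n"] that by auto
      also have "\<dots> < \<epsilon> * (r / 2)" using n by simp
      finally show ?thesis using \<epsilon> by (simp add: dist_norm)
    qed
    then show "\<exists>M. \<forall>m\<ge>M. \<forall>n\<ge>M. dist (x m) (x n) < r"
      by (meson dist_triangle_half_l)
  qed
  then obtain x0 where x0: "x \<longlonglongrightarrow> x0" by (auto simp: Cauchy_convergent_iff convergent_def)
  have x0A: "x0 \<in> A (x n)" for n
  proof -
    have "closed (A (x n))"
      unfolding A_def using D(1) bounded_linear.continuous_on[OF l continuous_on_id]
      by (intro closed_Collect_conj closed_Collect_le continuous_intros) auto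
    moreover have "x (k + n) \<in> A (x n)" for k using tail[of n k] by (simp add: add.commute)
    moreover have "(\<lambda>k. x (k + n)) \<longlonglongrightarrow> x0" using x0 by (rule LIMSEQ_ignore_initial_segment)
    ultimately show ?thesis by (rule closed_sequentially)
  qed
  have "l y \<le> l x0 + \<epsilon> * norm (y - x0)" if "y \<in> D" for y
  proof (rule ccontr)
    assume *: "\<not> ?thesis"
    then have "y \<in> A x0" using that by (simp add: A_def)
    then have "x \<longlonglongrightarrow> y" using lim_unique A_trans x0A by blast
    then have "y = x0" using x0 LIMSEQ_unique by blast
    then show False using * by simp
  qed
  moreover have "x0 \<in> D" using x0A by (simp add: A_def)
  ultimately show ?thesis using that by blast
qed

context banach_over
begin

text \<open>
  Ekeland's principle on the unit ball of the range of \<open>P\<close> gives a point \<open>x0\<close> where \<open>f\<close> is maximal up to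
  \<open>\<epsilon> * norm (x - x0)\<close>. The sandwich theorem places a linear \<open>g\<close> of norm at most \<open>\<epsilon>\<close> between the increments of
  \<open>f\<close> and this error, so \<open>f - g\<close> is maximal at \<open>x0\<close>. Composing with \<open>P\<close> extends this from the range of \<open>P\<close>
  to the whole space, since \<open>P\<close> does not increase norms.
\<close>

theorem bishop_phelps_invariant:
  fixes P :: "'a \<Rightarrow>\<^sub>L 'a" and f :: "'a \<Rightarrow>\<^sub>L 'k"
  assumes P: "P \<in> ops scale scale" "\<And>x. P (P x) = P x" "norm P \<le> 1"
    and f: "f \<in> dual scale" "\<And>x. f (P x) = f x" and \<epsilon>: "\<epsilon> > 0"
  obtains z x where "z \<in> dual scale" "\<And>x. z (P x) = z x" "norm (z - f) \<le> \<epsilon>"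
    "norm x \<le> 1" "norm (z x) = norm z"
proof -
  define D where "D = {x. P x = x \<and> norm x \<le> 1}"
  let ?l = "\<lambda>x. re_part (f x)"
  have l: "bounded_linear ?l"
    by (rule bounded_linear_compose[OF bounded_linear_re_part blinfun.bounded_linear_right])
  have "closed D"
    unfolding D_def by (intro closed_Collect_conj closed_Collect_eq closed_Collect_le continuous_intros)
  moreover have "0 \<in> D" by (simp add: D_def)
  moreover have "bdd_above (?l ` D)"
  proof (rule bdd_aboveI2)
    fix x assume "x \<in> D"
    have "?l x \<le> norm (f x)" by (rule re_part_le_norm)
    also have "\<dots> \<le> norm f * norm x" by (rule norm_blinfun)
    also have "\<dots> \<le> norm f * 1" using \<open>x \<in> D\<close> by (intro mult_left_mono) (auto simp: D_def)
    finally show "?l x \<le> norm f" by simp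
  qed
  ultimately obtain x0 where x0: "x0 \<in> D" "\<And>y. y \<in> D \<Longrightarrow> ?l y \<le> ?l x0 + \<epsilon> * norm (y - x0)"
    using linear_ekeland[OF _ _ l _ \<epsilon>, of D] by blast
  have D_convex: "a *\<^sub>R x + b *\<^sub>R y \<in> D" if "x \<in> D" "y \<in> D" "0 \<le> a" "0 \<le> b" "a + b = 1" for x y a b
  proof -
    have "norm (a *\<^sub>R x + b *\<^sub>R y) \<le> a * norm x + b * norm y"
      using that by (intro order_trans[OF norm_triangle_ineq]) simp
    also have "\<dots> \<le> a * 1 + b * 1" using that by (intro add_mono mult_left_mono) (auto simp: D_def)
    finally show ?thesis using that by (simp add: D_def blinfun.add_right blinfun.scaleR_right)
  qed
  define C where "C = {(t *\<^sub>R (x - x0), t * ?l (x - x0)) | t x. 0 \<le> t \<and> x \<in> D}"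
  have p: "sublinear (\<lambda>x::'a. \<epsilon> * norm x)" using \<epsilon> by (intro sublinear_norm) simp
  have C: "compatible_cone (\<lambda>x. \<epsilon> * norm x) C"
    unfolding compatible_cone_def
  proof (intro conjI ballI allI impI)
    have "(0 *\<^sub>R (x0 - x0), 0 * ?l (x0 - x0)) \<in> C" unfolding C_def using x0(1) by blast
    then show "(0, 0) \<in> C" by simp
    fix c assume "c \<in> C"
    then obtain t x where c: "c = (t *\<^sub>R (x - x0), t * ?l (x - x0))" "0 \<le> t" "x \<in> D"
      by (auto simp: C_def)
    show "snd c \<le> \<epsilon> * norm (fst c)"
    proof -
      have "?l (x - x0) \<le> \<epsilon> * norm (x - x0)"
        using x0(2)[OF c(3)] by (simp add: linear_diff[OF linear_re_dual])
      then have "t * ?l (x - x0) \<le> t * (\<epsilon> * norm (x - x0))" using c(2) by (intro mult_left_mono)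
      then show ?thesis using c by (simp add: mult.left_commute)
    qed
    show "r *\<^sub>R c \<in> C" if "0 < r" for r
      unfolding C_def using c that by (auto intro!: exI[of _ "r * t"] exI[of _ x])
    fix d assume "d \<in> C"
    then obtain u y where d: "d = (u *\<^sub>R (y - x0), u * ?l (y - x0))" "0 \<le> u" "y \<in> D"
      by (auto simp: C_def)
    show "c + d \<in> C"
    proof (cases "t + u = 0")
      case True
      then have "t = 0" "u = 0" using c d by auto
      then show ?thesis using \<open>(0, 0) \<in> C\<close> c d by (simp add: zero_prod_def)
    next
      case False
      define v where "v = (t / (t + u)) *\<^sub>R x + (u / (t + u)) *\<^sub>R y"
      have "v \<in> D"
        unfolding v_def using c d False by (intro D_convex) (auto simp: add_divide_distrib[symmetric])
      moreover have eq: "t *\<^sub>R (x - x0) + u *\<^sub>R (y - x0) = (t + u) *\<^sub>R (v - x0)"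
      proof -
        have "(t + u) *\<^sub>R v = t *\<^sub>R x + u *\<^sub>R y" using False by (simp add: v_def scaleR_add_right)
        then show ?thesis by (simp add: algebra_simps)
      qed
      moreover have "t * ?l (x - x0) + u * ?l (y - x0) = (t + u) * ?l (v - x0)"
      proof -
        have "t * ?l (x - x0) + u * ?l (y - x0) = ?l (t *\<^sub>R (x - x0) + u *\<^sub>R (y - x0))"
          by (simp only: linear_add[OF linear_re_dual] linear_scale[OF linear_re_dual]) simp
        also have "\<dots> = (t + u) * ?l (v - x0)"
          by (simp only: eq linear_scale[OF linear_re_dual]) simp
        finally show ?thesis .
      qed
      ultimately show ?thesis
        unfolding C_def using c d by (auto intro!: exI[of _ "t + u"] exI[of _ v])
    qed
  qed
  obtain g where g: "linear g" "g \<le> (\<lambda>x. \<epsilon> * norm x)" "\<And>c. c \<in> C \<Longrightarrow> snd c \<le> g (fst c)"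
    using sandwich[OF p C] by blast
  obtain F :: "'a \<Rightarrow>\<^sub>L 'k" where F: "F \<in> dual scale" "\<And>y. re_part (F y) = g y" "norm F \<le> \<epsilon>"
    using complexify[OF g(1), of \<epsilon>] g(2) \<epsilon> by (auto simp: le_fun_def)
  define z where "z = f - (F o\<^sub>L P)"
  have z_apply: "z x = f x - F (P x)" for x by (simp add: z_def blinfun.diff_left)
  have z: "z \<in> dual scale"
    using f(1) F(1) P(1) by (simp add: dual_iff ops_iff z_apply algebra_simps)
  have inv: "z (P x) = z x" for x by (simp add: z_apply P f)
  have "norm (F o\<^sub>L P) \<le> norm F * norm P" by (rule norm_blinfun_compose)
  also have "\<dots> \<le> \<epsilon> * 1" using F(3) P(3) \<epsilon> by (intro mult_mono) auto
  finally have "norm (F o\<^sub>L P) \<le> \<epsilon>" by simp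
  then have near: "norm (z - f) \<le> \<epsilon>" by (simp add: z_def)
  have Px: "norm (P x) \<le> norm x" for x
    using norm_blinfun[of P x] P(3) mult_right_mono[of "norm P" 1 "norm x"] by simp
  have max: "re_part (z x) \<le> re_part (z x0)" if "norm x \<le> 1" for x
  proof -
    have "P x \<in> D" using that Px[of x] by (simp add: D_def P)
    then have "(1 *\<^sub>R (P x - x0), 1 * ?l (P x - x0)) \<in> C" unfolding C_def by force
    from g(3)[OF this] have "?l (P x) - ?l x0 \<le> g (P x) - g x0"
      by (simp add: linear_diff[OF linear_re_dual] linear_diff[OF g(1)])
    moreover have "P x0 = x0" using x0 by (simp add: D_def)
    moreover have "re_part (z x) = re_part (z (P x))" by (simp add: inv)
    ultimately show ?thesis by (simp add: z_apply P linear_diff[OF linear_re_part] F(2))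
  qed
  have "re_part (z y) \<le> re_part (z x0) * norm y" for y
  proof (cases "y = 0")
    case False
    have "re_part (z ((1 / norm y) *\<^sub>R y)) \<le> re_part (z x0)" using False by (intro max) simp
    then show ?thesis using False
      by (simp add: blinfun.scaleR_right linear_scale[OF linear_re_part] field_simps)
  qed (simp add: linear_0[OF linear_re_part])
  then have "norm (z y) \<le> re_part (z x0) * norm y" for y by (rule norm_dual_le[OF z])
  moreover have "0 \<le> re_part (z x0)" using max[of 0] by (simp add: linear_0[OF linear_re_part])
  ultimately have "norm z \<le> re_part (z x0)" by (intro norm_blinfun_bound)
  also have "\<dots> \<le> norm (z x0)" by (rule re_part_le_norm)
  finally have "norm z \<le> norm (z x0)" .
  moreover have x01: "norm x0 \<le> 1" using x0 by (simp add: D_def)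
  then have "norm (z x0) \<le> norm z"
    using norm_blinfun[of z x0] mult_left_mono[of "norm x0" 1 "norm z"] by simp
  ultimately show ?thesis using that z inv near x01 by (metis antisym)
qed

end

section \<open>Averaging over a compact group of isometries\<close>

lemma compose_blinfun_assoc: "(A o\<^sub>L B) o\<^sub>L C = A o\<^sub>L (B o\<^sub>L C)"
  by (rule blinfun_eqI) simp

lemma compose_id_blinfun: "A o\<^sub>L id_blinfun = A" "id_blinfun o\<^sub>L A = A"
  by (auto intro: blinfun_eqI)

text \<open>
  Let \<open>m\<close> be the infimum of the diameters of the orbits of points of the convex hull, and suppose
  that \<open>m > 0\<close>. Take \<open>u\<close> whose orbit has diameter almost \<open>m\<close>, and let \<open>u'\<close> be the average of the images of \<open>u\<close> under a
  finite net \<open>F\<close>. Every point of the orbit of \<open>u\<close> is close to one of these images, hence its distance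
  to \<open>u'\<close> falls short of the diameter by a definite fraction. This fraction depends on the cardinality of \<open>F\<close> only, because the net is
  uniform in \<open>u\<close>; so the orbit of \<open>u'\<close> would have diameter less than \<open>m\<close>.
\<close>

lemma almost_fixed_point:
  fixes \<Gamma> :: "('e::real_normed_vector \<Rightarrow> 'e) set"
  assumes lin: "\<And>\<tau>. \<tau> \<in> \<Gamma> \<Longrightarrow> linear \<tau>" and iso: "\<And>\<tau> u. \<tau> \<in> \<Gamma> \<Longrightarrow> norm (\<tau> u) = norm u"
    and comp: "\<And>\<tau> \<sigma>. \<tau> \<in> \<Gamma> \<Longrightarrow> \<sigma> \<in> \<Gamma> \<Longrightarrow> \<tau> \<circ> \<sigma> \<in> \<Gamma>"
    and id: "id \<in> \<Gamma>" and inv: "\<And>\<tau>. \<tau> \<in> \<Gamma> \<Longrightarrow> \<exists>\<sigma>\<in>\<Gamma>. \<tau> \<circ> \<sigma> = id"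
    and net: "\<And>s. s > 0 \<Longrightarrow> \<exists>F\<subseteq>\<Gamma>. finite F \<and> (\<forall>\<tau>\<in>\<Gamma>. \<exists>\<sigma>\<in>F. \<forall>u. norm (\<tau> u - \<sigma> u) \<le> s * norm u)"
    and \<delta>: "\<delta> > 0"
  obtains u where "u \<in> convex hull ((\<lambda>\<tau>. \<tau> v) ` \<Gamma>)" "\<And>\<tau>. \<tau> \<in> \<Gamma> \<Longrightarrow> norm (\<tau> u - u) \<le> \<delta>"
proof -
  define W where "W = convex hull ((\<lambda>\<tau>. \<tau> v) ` \<Gamma>)"
  define diam_le where "diam_le r u \<longleftrightarrow> (\<forall>\<tau>\<in>\<Gamma>. \<forall>\<sigma>\<in>\<Gamma>. norm (\<tau> u - \<sigma> u) \<le> r)" for r u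
  have W_norm: "norm u \<le> norm v" if "u \<in> W" for u
  proof -
    have "W \<subseteq> cball 0 (norm v)" unfolding W_def by (rule hull_minimal) (auto intro: eq_refl[OF iso])
    with that show ?thesis by auto
  qed
  have W_inv: "\<tau> u \<in> W" if "\<tau> \<in> \<Gamma>" "u \<in> W" for \<tau> u
  proof -
    have "\<tau> u \<in> convex hull (\<tau> ` (\<lambda>\<tau>. \<tau> v) ` \<Gamma>)"
      using that convex_hull_linear_image[OF lin[OF that(1)], of "(\<lambda>\<tau>. \<tau> v) ` \<Gamma>"] by (auto simp: W_def)
    also have "\<dots> \<subseteq> W"
    proof -
      have "\<tau> ` (\<lambda>\<tau>. \<tau> v) ` \<Gamma> \<subseteq> (\<lambda>\<tau>. \<tau> v) ` \<Gamma>"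
      proof clarify
        fix \<sigma> assume "\<sigma> \<in> \<Gamma>"
        from comp[OF that(1) this] show "\<tau> (\<sigma> v) \<in> (\<lambda>\<tau>. \<tau> v) ` \<Gamma>"
          by (rule rev_image_eqI) simp
      qed
      then show ?thesis unfolding W_def by (rule hull_mono)
    qed
    finally show ?thesis .
  qed
  have vW: "v \<in> W" unfolding W_def using id by (intro hull_inc rev_image_eqI[of id]) auto
  define R where "R = {r. 0 \<le> r \<and> (\<exists>u\<in>W. diam_le r u)}"
  have "norm (\<tau> v - \<sigma> v) \<le> norm v + norm v" if "\<tau> \<in> \<Gamma>" "\<sigma> \<in> \<Gamma>" for \<tau> \<sigma>
    using norm_triangle_ineq4[of "\<tau> v" "\<sigma> v"] iso[OF that(1)] iso[OF that(2)] by simp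
  then have "diam_le (norm v + norm v) v" by (simp add: diam_le_def)
  then have R_ne: "norm v + norm v \<in> R"
    unfolding R_def by (intro CollectI conjI bexI[OF _ vW]) auto
  have R_bdd: "bdd_below R" by (rule bdd_belowI[of _ 0]) (simp add: R_def)
  define m where "m = Inf R"
  have "0 \<le> m" unfolding m_def by (rule cInf_greatest) (use R_ne in blast, simp add: R_def)
  moreover have "\<not> 0 < m"
  proof
    assume m0: "0 < m"
    define d where "d = norm v + 1"
    have pos: "0 < d" unfolding d_def using norm_ge_zero[of v] by linarith
    define s where "s = m / (2 * d)"
    have "s > 0" using m0 pos by (simp add: s_def)
    then obtain F where F: "F \<subseteq> \<Gamma>" "finite F" and
      F_net: "\<And>\<tau>. \<tau> \<in> \<Gamma> \<Longrightarrow> \<exists>\<sigma>\<in>F. \<forall>u. norm (\<tau> u - \<sigma> u) \<le> s * norm u"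
      using net[of s] by auto
    have F_close: "\<exists>\<sigma>\<in>F. norm (\<tau> u - \<sigma> u) \<le> m / 2" if \<tau>: "\<tau> \<in> \<Gamma>" and u: "u \<in> W" for \<tau> u
    proof -
      have "s * norm u \<le> s * d"
        using W_norm[OF u] \<open>s > 0\<close> by (intro mult_left_mono) (auto simp: d_def)
      also have "\<dots> = m / 2" using pos by (simp add: s_def)
      finally have le: "s * norm u \<le> m / 2" .
      obtain \<sigma> where "\<sigma> \<in> F" "\<forall>u. norm (\<tau> u - \<sigma> u) \<le> s * norm u" using F_net \<tau> by blast
      then show ?thesis using le order_trans by blast
    qed
    define n where "n = real (card F)"
    have "F \<noteq> {}" using F_net[OF id] by blast
    then have n: "1 \<le> n" using F(2) by (simp add: n_def Suc_leI card_gt_0_iff)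
    have "m < m + m / (2 * n)" using m0 n by simp
    then obtain r where r: "r \<in> R" "r < m + m / (2 * n)"
      unfolding m_def using cInf_lessD R_ne by (metis empty_iff)
    obtain u where u: "u \<in> W" "diam_le r u" using r(1) by (auto simp: R_def)
    have "m \<le> r" unfolding m_def by (rule cInf_lower[OF r(1) R_bdd])
    define u' where "u' = (\<Sum>\<sigma>\<in>F. (1 / n) *\<^sub>R \<sigma> u)"
    have n_sum: "(\<Sum>\<sigma>\<in>F. 1 / n) = 1" using n by (simp add: n_def)
    have u'W: "u' \<in> W"
      unfolding u'_def
      by (rule convex_sum[OF F(2) _ n_sum]) (use n F(1) u W_inv in \<open>auto simp: W_def\<close>)
    define r' where "r' = r - m / (2 * n)"
    have r': "0 \<le> r'" "r' < m"
    proof -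
      have "m / (2 * n) \<le> m / 1" using m0 n by (intro divide_left_mono) auto
      then show "0 \<le> r'" using \<open>m \<le> r\<close> by (simp add: r'_def)
    qed (use r(2) in \<open>simp add: r'_def\<close>)
    have avg: "norm (z - (\<Sum>\<sigma>\<in>F. (1 / n) *\<^sub>R y \<sigma>)) \<le> (\<Sum>\<sigma>\<in>F. (1 / n) * norm (z - y \<sigma>))"
      for z :: 'e and y :: "('e \<Rightarrow> 'e) \<Rightarrow> 'e"
    proof -
      have "z = (\<Sum>\<sigma>\<in>F. (1 / n) *\<^sub>R z)"
        using n_sum by (simp add: scaleR_sum_left[symmetric])
      then have "z - (\<Sum>\<sigma>\<in>F. (1 / n) *\<^sub>R y \<sigma>) = (\<Sum>\<sigma>\<in>F. (1 / n) *\<^sub>R (z - y \<sigma>))"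
        by (simp add: sum_subtractf scaleR_diff_right)
      also have "norm \<dots> \<le> (\<Sum>\<sigma>\<in>F. norm ((1 / n) *\<^sub>R (z - y \<sigma>)))" by (rule norm_sum)
      finally show ?thesis using n by simp
    qed
    have to_orbit: "norm (\<kappa> u - \<tau> u') \<le> r'" if \<tau>: "\<tau> \<in> \<Gamma>" and \<kappa>: "\<kappa> \<in> \<Gamma>" for \<tau> \<kappa>
    proof -
      obtain \<tau>' where \<tau>': "\<tau>' \<in> \<Gamma>" "\<tau> \<circ> \<tau>' = id" using inv[OF \<tau>] by blast
      have \<tau>'\<kappa>: "\<tau>' \<circ> \<kappa> \<in> \<Gamma>" by (rule comp[OF \<tau>'(1) \<kappa>])
      then obtain \<sigma>0 where \<sigma>0: "\<sigma>0 \<in> F" "norm ((\<tau>' \<circ> \<kappa>) u - \<sigma>0 u) \<le> m / 2"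
        using F_close[OF _ u(1)] by blast
      have "\<kappa> u = \<tau> ((\<tau>' \<circ> \<kappa>) u)" using \<tau>'(2) by (metis comp_apply id_apply)
      then have "norm (\<kappa> u - \<tau> u') = norm (\<tau> ((\<tau>' \<circ> \<kappa>) u - u'))"
        by (simp add: linear_diff[OF lin[OF \<tau>]])
      also have "\<dots> = norm ((\<tau>' \<circ> \<kappa>) u - u')" by (rule iso[OF \<tau>])
      also have "\<dots> \<le> (\<Sum>\<sigma>\<in>F. (1 / n) * norm ((\<tau>' \<circ> \<kappa>) u - \<sigma> u))"
        unfolding u'_def by (rule avg)
      also have "\<dots> \<le> (\<Sum>\<sigma>\<in>F. (1 / n) * (if \<sigma> = \<sigma>0 then m / 2 else r))"
      proof (intro sum_mono mult_left_mono)
        fix \<sigma> assume "\<sigma> \<in> F"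
        then have "norm ((\<tau>' \<circ> \<kappa>) u - \<sigma> u) \<le> r"
          using u(2) \<tau>'\<kappa> F(1) unfolding diam_le_def by blast
        then show "norm ((\<tau>' \<circ> \<kappa>) u - \<sigma> u) \<le> (if \<sigma> = \<sigma>0 then m / 2 else r)"
          using \<sigma>0(2) by auto
      qed (use n in simp)
      also have "\<dots> = (1 / n) * (m / 2 + (n - 1) * r)"
      proof -
        have "(\<Sum>\<sigma>\<in>F. if \<sigma> = \<sigma>0 then m / 2 else r) = m / 2 + (\<Sum>\<sigma>\<in>F - {\<sigma>0}. r)"
          by (subst sum.remove[OF F(2) \<sigma>0(1)]) (auto intro: sum.cong)
        also have "(\<Sum>\<sigma>\<in>F - {\<sigma>0}. r) = (n - 1) * r"
          using F(2) \<sigma>0(1) n by (simp add: n_def card_Diff_singleton of_nat_diff)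
        finally show ?thesis by (simp only: sum_distrib_left[symmetric])
      qed
      also have "\<dots> = r - (r - m / 2) / n" using n by (simp add: field_simps)
      also have "\<dots> \<le> r'"
      proof -
        have "(m / 2) / n \<le> (r - m / 2) / n" using \<open>m \<le> r\<close> n by (intro divide_right_mono) auto
        then show ?thesis by (simp add: r'_def)
      qed
      finally show ?thesis .
    qed
    have "diam_le r' u'"
      unfolding diam_le_def
    proof (intro ballI)
      fix \<tau> \<kappa> assume \<tau>: "\<tau> \<in> \<Gamma>" and \<kappa>: "\<kappa> \<in> \<Gamma>"
      have "\<kappa> u' = (\<Sum>\<sigma>\<in>F. (1 / n) *\<^sub>R (\<kappa> \<circ> \<sigma>) u)"
        by (simp add: u'_def linear_sum[OF lin[OF \<kappa>]] linear_scale[OF lin[OF \<kappa>]])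
      then have "norm (\<tau> u' - \<kappa> u') \<le> (\<Sum>\<sigma>\<in>F. (1 / n) * norm (\<tau> u' - (\<kappa> \<circ> \<sigma>) u))"
        using avg[of "\<tau> u'" "\<lambda>\<sigma>. (\<kappa> \<circ> \<sigma>) u"] by simp
      also have "\<dots> \<le> (\<Sum>\<sigma>\<in>F. (1 / n) * r')"
        using to_orbit[OF \<tau> comp[OF \<kappa>]] F(1) n
        by (intro sum_mono mult_left_mono) (auto simp: norm_minus_commute)
      also have "\<dots> = r'" using n_sum by (simp add: sum_distrib_right[symmetric])
      finally show "norm (\<tau> u' - \<kappa> u') \<le> r'" .
    qed
    then have "r' \<in> R" using u'W r'(1) by (auto simp: R_def)
    then have "m \<le> r'" unfolding m_def by (rule cInf_lower[OF _ R_bdd])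
    with r'(2) show False by simp
  qed
  ultimately have "m < \<delta>" using \<delta> by simp
  then obtain r where "r \<in> R" "r < \<delta>" unfolding m_def using cInf_lessD R_ne by (metis empty_iff)
  then obtain u where "u \<in> W" "diam_le r u" by (auto simp: R_def)
  then have "norm (\<tau> u - u) \<le> \<delta>" if "\<tau> \<in> \<Gamma>" for \<tau>
    using that id \<open>r < \<delta>\<close> unfolding diam_le_def by (metis id_apply le_less order_trans)
  then show ?thesis using that \<open>u \<in> W\<close> by (simp add: W_def)
qed

lemma closed_convex_vimage:
  fixes f :: "'a::real_normed_vector \<Rightarrow> 'b::real_normed_vector"
  assumes "bounded_linear f" "closed S" "convex S"
  shows "closed (f -` S)" "convex (f -` S)"
  using assms closed_vimage bounded_linear.continuous_on[OF assms(1), of UNIV]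
  by (auto intro!: convex_linear_vimage continuous_closed_vimage simp: bounded_linear.linear
      linear_continuous_at)

lemma closure_convex_hull_subset:
  fixes S :: "'a::real_normed_vector set"
  shows "G \<subseteq> S \<Longrightarrow> closed S \<Longrightarrow> convex S \<Longrightarrow> closure (convex hull G) \<subseteq> S"
  by (intro closure_minimal hull_minimal)

text \<open>
  A substitute for the Haar average of the elements of \<open>G\<close>. The group acts on operators by isometries from the right and
  from the left, and \<open>almost_fixed_point\<close> applied to the identity gives almost right-invariant averages \<open>\<Phi> n\<close>
  and almost left-invariant ones \<open>\<Psi> n\<close>. The product \<open>\<Phi> n \<circ> \<Psi> m\<close> is close to both of its factors, so the two sequences
  are Cauchy with the same limit.
\<close>

theorem invariant_mean:
  fixes G :: "('a::banach \<Rightarrow>\<^sub>L 'a) set"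
  assumes G: "isometry_group sX G" "compact G"
  obtains P where "P \<in> closure (convex hull G)" "\<And>g. g \<in> G \<Longrightarrow> P o\<^sub>L g = P" "\<And>g. g \<in> G \<Longrightarrow> g o\<^sub>L P = P"
proof -
  have id: "id_blinfun \<in> G" and comp: "\<And>g h. g \<in> G \<Longrightarrow> h \<in> G \<Longrightarrow> g o\<^sub>L h \<in> G"
    and inv: "\<And>g. g \<in> G \<Longrightarrow> \<exists>h\<in>G. g o\<^sub>L h = id_blinfun \<and> h o\<^sub>L g = id_blinfun"
    and iso: "\<And>g x. g \<in> G \<Longrightarrow> norm (blinfun_apply g x) = norm x"
    using G(1) by (auto simp: isometry_group_def operator_group_def)
  have norm_le1: "norm g \<le> 1" if "g \<in> G" for g
    using iso[OF that] by (intro norm_blinfun_bound) auto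
  have right_le: "norm (A o\<^sub>L g) \<le> norm A" and left_le: "norm (g o\<^sub>L A) \<le> norm A"
    if "g \<in> G" for g and A :: "'a \<Rightarrow>\<^sub>L 'a"
    using norm_blinfun_compose[of A g] norm_blinfun_compose[of g A] norm_le1[OF that]
      mult_left_mono[of "norm g" 1 "norm A"] mult_right_mono[of "norm g" 1 "norm A"] by auto
  have right_iso: "norm (A o\<^sub>L g) = norm A" and left_iso: "norm (g o\<^sub>L A) = norm A"
    if g: "g \<in> G" for g and A :: "'a \<Rightarrow>\<^sub>L 'a"
  proof -
    obtain h where h: "h \<in> G" "g o\<^sub>L h = id_blinfun" "h o\<^sub>L g = id_blinfun" using inv[OF g] by blast
    have "(A o\<^sub>L g) o\<^sub>L h = A" "h o\<^sub>L (g o\<^sub>L A) = A"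
      by (simp_all add: h(2,3) compose_blinfun_assoc compose_id_blinfun) (simp add: h(3) compose_id_blinfun flip: compose_blinfun_assoc)
    then show "norm (A o\<^sub>L g) = norm A" "norm (g o\<^sub>L A) = norm A"
      using right_le[OF g, of A] left_le[OF g, of A] right_le[OF h(1), of "A o\<^sub>L g"] left_le[OF h(1), of "g o\<^sub>L A"] by auto
  qed
  have net: "\<exists>k\<subseteq>G. finite k \<and> (\<forall>g\<in>G. \<exists>h\<in>k. norm (g - h) \<le> s)" if s: "s > 0" for s
  proof -
    obtain k where k: "finite k" "k \<subseteq> G" "G \<subseteq> (\<Union>x\<in>k. ball x s)"
      using seq_compact_imp_totally_bounded G(2) s unfolding compact_eq_seq_compact_metric by metis
    have "\<exists>h\<in>k. norm (g - h) \<le> s" if g: "g \<in> G" for g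
    proof -
      obtain h where "h \<in> k" "g \<in> ball h s" using k(3) g by blast
      then show ?thesis by (intro bexI[of _ h]) (auto simp: dist_norm norm_minus_commute)
    qed
    with k show ?thesis by blast
  qed
  let ?R = "(\<lambda>g A :: 'a \<Rightarrow>\<^sub>L 'a. A o\<^sub>L g) ` G" and ?L = "(\<lambda>g A :: 'a \<Rightarrow>\<^sub>L 'a. g o\<^sub>L A) ` G"
  note bil = bounded_bilinear_blinfun_compose
  have right: "\<exists>\<Phi>\<in>convex hull G. \<forall>g\<in>G. norm ((\<Phi> o\<^sub>L g) - \<Phi>) \<le> \<delta>" if \<delta>: "\<delta> > 0" for \<delta>
  proof -
    have "\<exists>F\<subseteq>?R. finite F \<and> (\<forall>\<tau>\<in>?R. \<exists>\<sigma>\<in>F. \<forall>u. norm (\<tau> u - \<sigma> u) \<le> s * norm u)" if "s > 0" for s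
    proof -
      obtain k where k: "k \<subseteq> G" "finite k" "\<And>g. g \<in> G \<Longrightarrow> \<exists>h\<in>k. norm (g - h) \<le> s"
        using net[OF \<open>s > 0\<close>] by blast
      have near: "norm ((u o\<^sub>L g) - (u o\<^sub>L h)) \<le> s * norm u" if "norm (g - h) \<le> s" for g h u :: "'a \<Rightarrow>\<^sub>L 'a"
        using norm_blinfun_compose[of u "g - h"] mult_left_mono[OF that, of "norm u"]
        by (simp add: bounded_bilinear.diff_right[OF bil] mult.commute)
      have "\<exists>\<sigma>\<in>(\<lambda>g A. A o\<^sub>L g) ` k. \<forall>u. norm (\<tau> u - \<sigma> u) \<le> s * norm u" if \<tau>: "\<tau> \<in> ?R" for \<tau>
      proof -
        obtain g where "g \<in> G" "\<tau> = (\<lambda>A. A o\<^sub>L g)" using \<tau> by blast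
        moreover from this obtain h where "h \<in> k" "norm (g - h) \<le> s" using k(3) by blast
        ultimately show ?thesis using near by (intro bexI[of _ "(\<lambda>A. A o\<^sub>L h)"]) auto
      qed
      with k(1,2) show ?thesis by (intro exI[of _ "(\<lambda>g A. A o\<^sub>L g) ` k"]) (simp add: image_mono)
    qed
    note net_R = this
    obtain \<Phi> where \<Phi>: "\<Phi> \<in> convex hull ((\<lambda>\<tau>. \<tau> id_blinfun) ` ?R)" "\<And>\<tau>. \<tau> \<in> ?R \<Longrightarrow> norm (\<tau> \<Phi> - \<Phi>) \<le> \<delta>"
    proof (rule almost_fixed_point[of ?R \<delta> id_blinfun])
      fix \<tau> assume \<tau>: "\<tau> \<in> ?R"
      then obtain g where g: "g \<in> G" "\<tau> = (\<lambda>A. A o\<^sub>L g)" by blast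
      show "linear \<tau>" unfolding g by (intro bounded_linear.linear bounded_bilinear.bounded_linear_left[OF bil])
      show "norm (\<tau> u) = norm u" for u unfolding g by (rule right_iso[OF g(1)])
      show "\<exists>\<sigma>\<in>?R. \<tau> \<circ> \<sigma> = id"
      proof -
        obtain h where h: "h \<in> G" "h o\<^sub>L g = id_blinfun" using inv[OF g(1)] by blast
        have "\<tau> \<circ> (\<lambda>A. A o\<^sub>L h) = id"
          by (rule ext) (simp add: g(2) compose_blinfun_assoc h(2) compose_id_blinfun)
        then show ?thesis using h(1) by blast
      qed
      show "\<tau> \<circ> \<sigma> \<in> ?R" if \<sigma>: "\<sigma> \<in> ?R" for \<sigma>
      proof -
        obtain h where h: "h \<in> G" "\<sigma> = (\<lambda>A. A o\<^sub>L h)" using \<sigma> by blast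
        have "\<tau> \<circ> \<sigma> = (\<lambda>A. A o\<^sub>L (h o\<^sub>L g))"
          by (rule ext) (simp add: g(2) h(2) compose_blinfun_assoc)
        then show ?thesis using comp g(1) h(1) by blast
      qed
    next
      have "id = (\<lambda>A. A o\<^sub>L id_blinfun)" by (rule ext) (simp add: compose_id_blinfun)
      then show "id \<in> ?R" using id by blast
    qed (use net_R \<delta> in auto)
    moreover have "(\<lambda>\<tau>. \<tau> id_blinfun) ` ?R = G" by (auto simp: image_image compose_id_blinfun)
    ultimately show ?thesis by auto
  qed
  have left: "\<exists>\<Psi>\<in>convex hull G. \<forall>g\<in>G. norm ((g o\<^sub>L \<Psi>) - \<Psi>) \<le> \<delta>" if \<delta>: "\<delta> > 0" for \<delta>
  proof -
    have "\<exists>F\<subseteq>?L. finite F \<and> (\<forall>\<tau>\<in>?L. \<exists>\<sigma>\<in>F. \<forall>u. norm (\<tau> u - \<sigma> u) \<le> s * norm u)" if "s > 0" for s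
    proof -
      obtain k where k: "k \<subseteq> G" "finite k" "\<And>g. g \<in> G \<Longrightarrow> \<exists>h\<in>k. norm (g - h) \<le> s"
        using net[OF \<open>s > 0\<close>] by blast
      have near: "norm ((g o\<^sub>L u) - (h o\<^sub>L u)) \<le> s * norm u" if "norm (g - h) \<le> s" for g h u :: "'a \<Rightarrow>\<^sub>L 'a"
        using norm_blinfun_compose[of "g - h" u] mult_right_mono[OF that, of "norm u"]
        by (simp add: bounded_bilinear.diff_left[OF bil])
      have "\<exists>\<sigma>\<in>(\<lambda>g A. g o\<^sub>L A) ` k. \<forall>u. norm (\<tau> u - \<sigma> u) \<le> s * norm u" if \<tau>: "\<tau> \<in> ?L" for \<tau>
      proof -
        obtain g where "g \<in> G" "\<tau> = (\<lambda>A. g o\<^sub>L A)" using \<tau> by blast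
        moreover from this obtain h where "h \<in> k" "norm (g - h) \<le> s" using k(3) by blast
        ultimately show ?thesis using near by (intro bexI[of _ "(\<lambda>A. h o\<^sub>L A)"]) auto
      qed
      with k(1,2) show ?thesis by (intro exI[of _ "(\<lambda>g A. g o\<^sub>L A) ` k"]) (simp add: image_mono)
    qed
    note net_L = this
    obtain \<Psi> where \<Psi>: "\<Psi> \<in> convex hull ((\<lambda>\<tau>. \<tau> id_blinfun) ` ?L)" "\<And>\<tau>. \<tau> \<in> ?L \<Longrightarrow> norm (\<tau> \<Psi> - \<Psi>) \<le> \<delta>"
    proof (rule almost_fixed_point[of ?L \<delta> id_blinfun])
      fix \<tau> assume \<tau>: "\<tau> \<in> ?L"
      then obtain g where g: "g \<in> G" "\<tau> = (\<lambda>A. g o\<^sub>L A)" by blast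
      show "linear \<tau>" unfolding g by (intro bounded_linear.linear bounded_bilinear.bounded_linear_right[OF bil])
      show "norm (\<tau> u) = norm u" for u unfolding g by (rule left_iso[OF g(1)])
      show "\<exists>\<sigma>\<in>?L. \<tau> \<circ> \<sigma> = id"
      proof -
        obtain h where h: "h \<in> G" "g o\<^sub>L h = id_blinfun" using inv[OF g(1)] by blast
        have "\<tau> \<circ> (\<lambda>A. h o\<^sub>L A) = id"
          by (rule ext) (simp add: g(2) compose_blinfun_assoc[symmetric] h(2) compose_id_blinfun)
        then show ?thesis using h(1) by blast
      qed
      show "\<tau> \<circ> \<sigma> \<in> ?L" if \<sigma>: "\<sigma> \<in> ?L" for \<sigma>
      proof -
        obtain h where h: "h \<in> G" "\<sigma> = (\<lambda>A. h o\<^sub>L A)" using \<sigma> by blast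
        have "\<tau> \<circ> \<sigma> = (\<lambda>A. (g o\<^sub>L h) o\<^sub>L A)"
          by (rule ext) (simp add: g(2) h(2) compose_blinfun_assoc[symmetric])
        then show ?thesis using comp g(1) h(1) by blast
      qed
    next
      have "id = (\<lambda>A. id_blinfun o\<^sub>L A)" by (rule ext) (simp add: compose_id_blinfun)
      then show "id \<in> ?L" using id by blast
    qed (use net_L \<delta> in auto)
    moreover have "(\<lambda>\<tau>. \<tau> id_blinfun) ` ?L = G" by (auto simp: image_image compose_id_blinfun)
    ultimately show ?thesis by auto
  qed
  have "\<exists>\<Phi>\<in>convex hull G. \<forall>g\<in>G. norm ((\<Phi> o\<^sub>L g) - \<Phi>) \<le> inverse (real (Suc n))" for n
    by (rule right) simp
  then obtain \<Phi> where \<Phi>: "\<And>n. \<Phi> n \<in> convex hull G" 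
    "\<And>n g. g \<in> G \<Longrightarrow> norm ((\<Phi> n o\<^sub>L g) - \<Phi> n) \<le> inverse (real (Suc n))" by metis
  have "\<exists>\<Psi>\<in>convex hull G. \<forall>g\<in>G. norm ((g o\<^sub>L \<Psi>) - \<Psi>) \<le> inverse (real (Suc n))" for n
    by (rule left) simp
  then obtain \<Psi> where \<Psi>: "\<And>n. \<Psi> n \<in> convex hull G"
    "\<And>n g. g \<in> G \<Longrightarrow> norm ((g o\<^sub>L \<Psi> n) - \<Psi> n) \<le> inverse (real (Suc n))" by metis
  have close: "norm (\<Phi> n - \<Psi> m) \<le> inverse (real (Suc n)) + inverse (real (Suc m))" for n m
  proof -
    have "convex hull G \<subseteq> (\<lambda>A. \<Phi> n o\<^sub>L A) -` cball (\<Phi> n) (inverse (real (Suc n)))"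
      using \<Phi>(2) bounded_bilinear.bounded_linear_right[OF bil]
      by (intro hull_minimal closed_convex_vimage) (auto simp: dist_norm norm_minus_commute)
    then have 1: "norm (\<Phi> n - (\<Phi> n o\<^sub>L \<Psi> m)) \<le> inverse (real (Suc n))"
      using \<Psi>(1)[of m] by (auto simp: dist_norm)
    have "convex hull G \<subseteq> (\<lambda>A. A o\<^sub>L \<Psi> m) -` cball (\<Psi> m) (inverse (real (Suc m)))"
      using \<Psi>(2) bounded_bilinear.bounded_linear_left[OF bil]
      by (intro hull_minimal closed_convex_vimage) (auto simp: dist_norm norm_minus_commute)
    then have 2: "norm ((\<Phi> n o\<^sub>L \<Psi> m) - \<Psi> m) \<le> inverse (real (Suc m))"
      using \<Phi>(1)[of n] by (auto simp: dist_norm norm_minus_commute)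
    show ?thesis using norm_triangle_ineq[of "\<Phi> n - (\<Phi> n o\<^sub>L \<Psi> m)" "(\<Phi> n o\<^sub>L \<Psi> m) - \<Psi> m"] 1 2 by simp
  qed
  have null: "(\<lambda>n. inverse (real (Suc n))) \<longlonglongrightarrow> 0" by (rule LIMSEQ_inverse_real_of_nat)
  have "Cauchy \<Phi>"
  proof (rule metric_CauchyI)
    fix r :: real assume "r > 0"
    then have "r / 4 > 0" by simp
    from order_tendstoD(2)[OF null this] obtain N where N: "\<And>n. n \<ge> N \<Longrightarrow> inverse (real (Suc n)) < r / 4"
      by (auto simp: eventually_sequentially)
    have "dist (\<Phi> m) (\<Phi> n) < r" if "m \<ge> N" "n \<ge> N" for m n
      using close[of m m] close[of n m] N[OF that(1)] N[OF that(2)]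
        norm_triangle_ineq4[of "\<Phi> m - \<Psi> m" "\<Phi> n - \<Psi> m"] by (simp add: dist_norm)
    then show "\<exists>M. \<forall>m\<ge>M. \<forall>n\<ge>M. dist (\<Phi> m) (\<Phi> n) < r" by blast
  qed
  then obtain P where P: "\<Phi> \<longlonglongrightarrow> P" by (auto simp: Cauchy_convergent_iff convergent_def)
  have "(\<lambda>n. \<Phi> n - \<Psi> n) \<longlonglongrightarrow> 0"
    by (rule Lim_null_comparison[OF always_eventually[OF allI[OF close]]])
      (use tendsto_add[OF null null] in simp)
  from tendsto_diff[OF P this] have P': "\<Psi> \<longlonglongrightarrow> P" by simp
  show ?thesis
  proof
    show "P \<in> closure (convex hull G)" unfolding closure_sequential using \<Phi>(1) P by blast
    fix g assume g: "g \<in> G"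
    have "(\<lambda>n. (\<Phi> n o\<^sub>L g) - \<Phi> n) \<longlonglongrightarrow> (P o\<^sub>L g) - P"
      by (intro tendsto_diff P bounded_linear.tendsto[OF bounded_bilinear.bounded_linear_left[OF bil]])
    moreover have "(\<lambda>n. (\<Phi> n o\<^sub>L g) - \<Phi> n) \<longlonglongrightarrow> 0"
      by (rule Lim_null_comparison[OF always_eventually null]) (use \<Phi>(2)[OF g] in auto)
    ultimately show "P o\<^sub>L g = P" using LIMSEQ_unique by fastforce
    have "(\<lambda>n. (g o\<^sub>L \<Psi> n) - \<Psi> n) \<longlonglongrightarrow> (g o\<^sub>L P) - P"
      by (intro tendsto_diff P' bounded_linear.tendsto[OF bounded_bilinear.bounded_linear_right[OF bil]])
    moreover have "(\<lambda>n. (g o\<^sub>L \<Psi> n) - \<Psi> n) \<longlonglongrightarrow> 0"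
      by (rule Lim_null_comparison[OF always_eventually null]) (use \<Psi>(2)[OF g] in auto)
    ultimately show "g o\<^sub>L P = P" using LIMSEQ_unique by fastforce
  qed
qed

context banach_over
begin

text \<open>
  Each property of \<open>P\<close> says that \<open>P\<close> belongs to some closed convex set, and each of these sets contains \<open>G\<close>.
\<close>

theorem invariant_projection:
  assumes G: "isometry_group scale G" "compact G"
  obtains P where "P \<in> ops scale scale" "norm P \<le> 1" "\<And>x. P (P x) = P x"
    "\<And>g x. g \<in> G \<Longrightarrow> P (blinfun_apply g x) = P x"
    "\<And>f :: 'a \<Rightarrow>\<^sub>L 'k. \<forall>g\<in>G. \<forall>x. f (blinfun_apply g x) = f x \<Longrightarrow> \<forall>x. f (P x) = f x"
proof -
  obtain P where P: "P \<in> closure (convex hull G)" "\<And>g. g \<in> G \<Longrightarrow> P o\<^sub>L g = P" "\<And>g. g \<in> G \<Longrightarrow> g o\<^sub>L P = P"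
    using invariant_mean[OF G] by blast
  have closed_convex: "P \<in> S" if "G \<subseteq> S" "closed S" "convex S" for S
    using closure_convex_hull_subset[OF that] P(1) by blast
  show ?thesis
  proof
    have scaler: "bounded_linear (scale c)" for c
      by (rule bounded_bilinear.bounded_linear_right[OF bounded_bilinear_scale])
    have "P \<in> (\<Inter>c. \<Inter>x. (\<lambda>A. blinfun_apply A (scale c x) - scale c (blinfun_apply A x)) -` {0})"
    proof (rule closed_convex)
      show "G \<subseteq> (\<Inter>c. \<Inter>x. (\<lambda>A. blinfun_apply A (scale c x) - scale c (blinfun_apply A x)) -` {0})"
        using G(1) by (auto simp: isometry_group_def operator_group_def ops_iff subset_iff)
      have "bounded_linear (\<lambda>A. blinfun_apply A (scale c x) - scale c (blinfun_apply A x))" for c x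
        by (intro bounded_linear_sub blinfun.bounded_linear_left bounded_linear_compose[OF scaler])
      from closed_convex_vimage[OF this, of "{0}"]
      show "closed (\<Inter>c. \<Inter>x. (\<lambda>A. blinfun_apply A (scale c x) - scale c (blinfun_apply A x)) -` {0})"
        "convex (\<Inter>c. \<Inter>x. (\<lambda>A. blinfun_apply A (scale c x) - scale c (blinfun_apply A x)) -` {0})"
        by (auto intro!: closed_INT convex_INT)
    qed
    then show "P \<in> ops scale scale" by (simp add: ops_iff)
    have "G \<subseteq> cball 0 1"
      using G(1) by (auto simp: isometry_group_def intro!: norm_blinfun_bound)
    then have "P \<in> cball 0 1" by (rule closed_convex) auto
    then show "norm P \<le> 1" by simp
    have "P \<in> (\<lambda>A. A o\<^sub>L P) -` {P}"
      using P(3) closed_convex_vimage[OF bounded_bilinear.bounded_linear_left[OF bounded_bilinear_blinfun_compose], of "{P}"]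
      by (intro closed_convex) auto
    then have "P o\<^sub>L P = P" by simp
    then show "P (P x) = P x" for x by (metis blinfun_apply_blinfun_compose)
    show "P (blinfun_apply g x) = P x" if "g \<in> G" for g x
      using P(2)[OF that] by (metis blinfun_apply_blinfun_compose)
    fix f :: "'a \<Rightarrow>\<^sub>L 'k" assume f: "\<forall>g\<in>G. \<forall>x. f (blinfun_apply g x) = f x"
    have "P \<in> (\<lambda>A. f o\<^sub>L A) -` {f}"
      using f closed_convex_vimage[OF bounded_bilinear.bounded_linear_right[OF bounded_bilinear_blinfun_compose], of "{f}"]
      by (intro closed_convex) (auto intro!: blinfun_eqI)
    then have "f o\<^sub>L P = f" by simp
    then show "\<forall>x. f (P x) = f x" by (metis blinfun_apply_blinfun_compose)
  qed
qed

end

section \<open>Operators invariant under both groups\<close>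

definition rank_one :: "('k \<Rightarrow> 'b \<Rightarrow> 'b) \<Rightarrow> ('a::real_normed_vector \<Rightarrow>\<^sub>L 'k::real_or_complex) \<Rightarrow> 'b::real_normed_vector
    \<Rightarrow> ('a \<Rightarrow>\<^sub>L 'b)"
  where "rank_one sY \<phi> y = Blinfun (\<lambda>x. sY (\<phi> x) y)"

definition invariant_operators :: "('k \<Rightarrow> 'a \<Rightarrow> 'a) \<Rightarrow> ('k \<Rightarrow> 'b \<Rightarrow> 'b) \<Rightarrow> ('a \<Rightarrow>\<^sub>L 'a) set \<Rightarrow> ('b \<Rightarrow>\<^sub>L 'b) set
    \<Rightarrow> ('a::real_normed_vector \<Rightarrow>\<^sub>L 'b::real_normed_vector) set"
  where "invariant_operators sX sY G H =
    {S \<in> ops sX sY. (\<forall>g\<in>G. \<forall>x. S (blinfun_apply g x) = S x) \<and> (\<forall>h\<in>H. \<forall>x. blinfun_apply h (S x) = S x)}"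

context banach_over
begin

lemma rank_one_apply: "rank_one scale \<phi> y x = scale (blinfun_apply \<phi> x) y"
  unfolding rank_one_def
  by (subst bounded_linear_Blinfun_apply)
    (auto intro: bounded_linear_compose[OF bounded_bilinear.bounded_linear_left[OF bounded_bilinear_scale]]
      blinfun.bounded_linear_right)

lemma norm_rank_one_le: "norm (rank_one scale \<phi> y) \<le> norm \<phi> * norm y"
proof (rule norm_blinfun_bound)
  fix x
  have "norm (\<phi> x) * norm y \<le> (norm \<phi> * norm x) * norm y"
    by (intro mult_right_mono norm_blinfun) simp
  then show "norm (rank_one scale \<phi> y x) \<le> norm \<phi> * norm y * norm x"
    by (simp add: rank_one_apply norm_scale mult_ac)
qed simp

end

locale banach_over_pair = X: banach_over sX + Y: banach_over sY
  for sX :: "'k::real_or_complex \<Rightarrow> 'x::banach \<Rightarrow> 'x" and sY :: "'k \<Rightarrow> 'y::banach \<Rightarrow> 'y" +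
  fixes G :: "('x \<Rightarrow>\<^sub>L 'x) set" and H :: "('y \<Rightarrow>\<^sub>L 'y) set"
  assumes H_ops: "H \<subseteq> ops sY sY"
begin

abbreviation inv_set :: "('x \<Rightarrow>\<^sub>L 'y) set"
  where "inv_set \<equiv> invariant_operators sX sY G H"

lemma add_rank_one_invariant:
  assumes S: "S \<in> inv_set" and \<phi>: "\<phi> \<in> dual sX" "\<And>g x. g \<in> G \<Longrightarrow> \<phi> (blinfun_apply g x) = \<phi> x"
    and y: "\<And>h. h \<in> H \<Longrightarrow> blinfun_apply h y = y"
  shows "S + rank_one sY \<phi> y \<in> inv_set"
proof -
  have "h (sY c y) = sY c y" if "h \<in> H" for h c
    using H_ops that y[OF that] by (auto simp: ops_iff subset_iff)
  then show ?thesis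
    using S \<phi> by (simp add: invariant_operators_def ops_iff dual_iff Y.rank_one_apply blinfun.add_left
        blinfun.add_right Y.scale_right_distrib)
qed

lemma scaleR_invariant: "S \<in> inv_set \<Longrightarrow> r *\<^sub>R S \<in> inv_set"
  by (simp add: invariant_operators_def ops_iff blinfun.scaleR_left blinfun.scaleR_right Y.scaleR_scale)

lemma closed_invariant: "closed inv_set"
proof -
  have "inv_set = (\<Inter>c. \<Inter>x. {S. blinfun_apply S (sX c x) = sY c (blinfun_apply S x)})
    \<inter> (\<Inter>g\<in>G. \<Inter>x. {S. blinfun_apply S (blinfun_apply g x) = blinfun_apply S x})
    \<inter> (\<Inter>h\<in>H. \<Inter>x. {S. blinfun_apply h (blinfun_apply S x) = blinfun_apply S x})"
    by (auto simp: invariant_operators_def ops_iff)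
  moreover have "closed {S :: 'x \<Rightarrow>\<^sub>L 'y. blinfun_apply S (sX c x) = sY c (blinfun_apply S x)}" for c x
    by (intro closed_Collect_eq continuous_intros
        bounded_linear.continuous_on[OF bounded_bilinear.bounded_linear_right[OF Y.bounded_bilinear_scale]])
  moreover have "closed {S :: 'x \<Rightarrow>\<^sub>L 'y. blinfun_apply S z = blinfun_apply S x}"
    "closed {S :: 'x \<Rightarrow>\<^sub>L 'y. blinfun_apply h (blinfun_apply S x) = blinfun_apply S x}" for x z h
    by (intro closed_Collect_eq continuous_intros)+
  ultimately show ?thesis by (simp add: closed_Int closed_INT)
qed

text \<open>
  For a norming functional \<open>f\<close> of \<open>h (T x) - T x\<close>, invariance of the adjoint gives \<open>f (h (T x)) = f (T x)\<close>, that is, \<open>h (T x) = T x\<close>.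
\<close>

lemma invariant_iff_adjoint_invariant:
  "T \<in> inv_set \<longleftrightarrow> T \<in> inv_ops sX sY G \<and> adjoint_op T \<in> dual_inv_ops sY sX (adjoint_op ` H)"
proof -
  have G: "T \<in> inv_ops sX sY G \<longleftrightarrow> T \<in> ops sX sY \<and> (\<forall>g\<in>G. \<forall>x. T (blinfun_apply g x) = T x)"
    by (simp add: inv_ops_def invariant_ops_def ops_def)
  have bounded: "adjoint_op T \<in> bounded_ops dual_scale (dual sY) dual_scale (dual sX)" if "T \<in> ops sX sY"
    unfolding bounded_ops_def
  proof (intro CollectI conjI ballI allI exI image_subsetI)
    fix f g :: "'y \<Rightarrow>\<^sub>L 'k" and c assume "f \<in> dual sY"
    then show "adjoint_op T f \<in> dual sX" using that by (simp add: dual_iff ops_iff adjoint_op_def)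
    show "adjoint_op T (f + g) = adjoint_op T f + adjoint_op T g"
      by (rule blinfun_eqI) (simp add: adjoint_op_def blinfun.add_left)
    show "adjoint_op T (dual_scale c f) = dual_scale c (adjoint_op T f)"
      by (rule blinfun_eqI) (simp add: adjoint_op_def dual_scale_def)
    show "norm (adjoint_op T f) \<le> norm T * norm f"
      using norm_blinfun_compose[of f T] by (simp add: adjoint_op_def mult.commute)
  qed
  have "(\<forall>h\<in>H. \<forall>f\<in>dual sY. adjoint_op T (adjoint_op h f) = adjoint_op T f) \<longleftrightarrow> (\<forall>h\<in>H. \<forall>x. blinfun_apply h (T x) = T x)"
  proof (intro iffI ballI allI)
    fix h x assume *: "\<forall>h\<in>H. \<forall>f\<in>dual sY. adjoint_op T (adjoint_op h f) = adjoint_op T f" and h: "h \<in> H"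
    obtain e :: "'y \<Rightarrow>\<^sub>L 'k" where e: "e extreme_point_of (dual sY \<inter> cball 0 1)"
      "e (h (T x) - T x) = of_real (norm (h (T x) - T x))" by (rule Y.extreme_norming_functional)
    have "adjoint_op T (adjoint_op h e) x = adjoint_op T e x"
      using * h e(1) by (auto simp: extreme_point_of_def)
    then show "h (T x) = T x" using e(2) by (simp add: adjoint_op_def blinfun.diff_right)
  qed (auto intro!: blinfun_eqI simp: adjoint_op_def)
  with G bounded show ?thesis
    by (auto simp: invariant_operators_def dual_inv_ops_def invariant_ops_def)
qed

section \<open>The Lindenstrauss iteration\<close>

text \<open>
  Put \<open>T\<^sub>k\<^sub>+\<^sub>1 = T\<^sub>k + e\<^sub>k (f\<^sub>k \<circ> T\<^sub>k) \<cdot> z\<^sub>k\<close>, where \<open>z\<^sub>k = T\<^sub>k x\<^sub>k\<close> almost attains the norm of \<open>T\<^sub>k\<close> and \<open>f\<^sub>k\<close> norms \<open>z\<^sub>k\<close>.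
  Evaluation at \<open>x\<^sub>k\<close> shows that the norm grows by about \<open>e\<^sub>k norm T\<^sub>k ^ 2\<close>, the most that the added term permits. As the
  later \<open>e\<^sub>j\<close> are far smaller, \<open>f\<^sub>j (T\<^sub>j x\<^sub>j)\<close> for \<open>j > k\<close> can be as large as the norm of \<open>T\<^sub>k\<^sub>+\<^sub>1\<close> only if
  \<open>\<bar>f\<^sub>j z\<^sub>k\<bar>\<close> is almost \<open>norm T\<^sub>k\<close>. Hence \<open>f\<^sub>j\<close> almost norms all \<open>z\<^sub>k\<close> with \<open>k < j\<close> at the same time.
\<close>

theorem lindenstrauss_iteration:
  assumes T: "T \<in> inv_set" "norm T = 1" and \<epsilon>: "0 < \<epsilon>"
  obtains S x where "S \<in> inv_set" "norm (S - T) \<le> \<epsilon>" "\<And>k. norm (x k) \<le> 1"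
    "\<And>j. \<exists>f\<in>dual sY \<inter> cball 0 1. \<forall>k<j. norm S - 2 / 2 ^ k \<le> norm (blinfun_apply f (S (x k)))"
proof -
  have almost_norming: "\<exists>x. norm x \<le> 1 \<and> norm S - \<delta> \<le> norm (S x)" if "0 < \<delta>" for S :: "'x \<Rightarrow>\<^sub>L 'y" and \<delta>
  proof (rule ccontr)
    assume "\<not> ?thesis"
    then have *: "norm (S x) \<le> norm S - \<delta>" if "norm x \<le> 1" for x using that by force
    have "norm (S x) \<le> (norm S - \<delta>) * norm x" for x
    proof (cases "x = 0")
      case False
      then show ?thesis using *[of "(1 / norm x) *\<^sub>R x"]
        by (simp add: blinfun.scaleR_right field_simps)
    qed simp
    moreover have "0 \<le> norm S - \<delta>" using *[of 0] by simp
    ultimately have "norm S \<le> norm S - \<delta>" by (intro norm_blinfun_bound)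
    with that show False by simp
  qed
  define X where "X S \<delta> = (SOME x. norm x \<le> 1 \<and> norm S - \<delta> \<le> norm (S x))" for S :: "'x \<Rightarrow>\<^sub>L 'y" and \<delta>
  have X: "norm (X S \<delta>) \<le> 1" "norm S - \<delta> \<le> norm (S (X S \<delta>))" if "0 < \<delta>" for S :: "'x \<Rightarrow>\<^sub>L 'y" and \<delta>
    using someI_ex[OF almost_norming[OF that, of S], folded X_def] by auto
  have "\<exists>f\<in>dual sY \<inter> cball 0 1. f y = of_real (norm y)" for y
    using Y.extreme_norming_functional[of y] by (metis extreme_point_of_def)
  then obtain F where F: "\<And>y. F y \<in> dual sY \<inter> cball 0 1" "\<And>y. F y y = of_real (norm y)" by metis
  define a where "a = min (\<epsilon> / 8) (1 / 16)"
  \<comment> \<open>The steps decrease faster than geometrically: the error in \<open>key\<close>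
      contains the quotient \<open>e (Suc k) / e k\<close>, and these errors have to be
      summable.\<close>
  define e where "e = rec_nat a (\<lambda>k r. r / 2 ^ (k + 4))"
  have e_0: "e 0 = a" and e_Suc: "e (Suc k) = e k / 2 ^ (k + 4)" for k by (simp_all add: e_def)
  have a: "0 < a" "a \<le> \<epsilon> / 8" "a \<le> 1 / 16" using \<epsilon> by (auto simp: a_def)
  have e_pos: "0 < e k" for k by (induction k) (simp_all add: e_0 e_Suc a)
  have e_16: "e (Suc k) \<le> e k / 16" for k
  proof -
    have "e k / 2 ^ (k + 4) \<le> e k / 2 ^ 4" using e_pos[of k] by (intro divide_left_mono power_increasing) auto
    then show ?thesis by (simp add: e_Suc)
  qed
  have e_Suc_le: "e (Suc k) \<le> e k" for k using e_16[of k] e_pos[of k] by simp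
  have e_le: "e k \<le> a / 2 ^ k" for k
  proof (induction k)
    case (Suc k)
    then show ?case using e_16[of k] e_pos[of k] by simp
  qed (simp add: e_0)
  have e_le_a: "e k \<le> a" for k
  proof (induction k)
    case (Suc k)
    then show ?case using e_16[of k] e_pos[of k] by simp
  qed (simp add: e_0)
  define step where "step k S = S + rank_one sY (e k *\<^sub>R (F (S (X S (e (Suc k)))) o\<^sub>L S)) (S (X S (e (Suc k))))" for k and S :: "'x \<Rightarrow>\<^sub>L 'y"
  define Ts where "Ts = rec_nat T step"
  define x where "x k = X (Ts k) (e (Suc k))" for k
  define z where "z k = Ts k (x k)" for k
  define f where "f k = F (z k)" for k
  have Ts_0: "Ts 0 = T" by (simp add: Ts_def)
  have Ts_Suc: "Ts (Suc k) = Ts k + rank_one sY (e k *\<^sub>R (f k o\<^sub>L Ts k)) (z k)" for k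
    by (simp add: Ts_def step_def x_def z_def f_def)
  have x: "norm (x k) \<le> 1" and z_ge: "norm (Ts k) - e (Suc k) \<le> norm (z k)" for k
    unfolding x_def z_def using X e_pos by auto
  have f: "f k \<in> dual sY \<inter> cball 0 1" "f k (z k) = of_real (norm (z k))" for k
    using F by (auto simp: f_def)
  have f1: "norm (f k y) \<le> norm y" for k y by (rule Y.dual_unit_ball_le[OF f(1)])
  have apply_le: "norm (S (x k)) \<le> norm S" for S :: "'x \<Rightarrow>\<^sub>L 'y" and k
    using norm_blinfun[of S "x k"] mult_left_mono[OF x[of k], of "norm S"] by simp
  have z_le: "norm (z k) \<le> norm (Ts k)" for k unfolding z_def by (rule apply_le)
  have fT_le: "norm (f k o\<^sub>L Ts k) \<le> norm (Ts k)" for k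
    using norm_blinfun_compose[of "f k" "Ts k"] f(1)[of k] mult_right_mono[of "norm (f k)" 1 "norm (Ts k)"] by simp
  have inv: "Ts k \<in> inv_set" for k
  proof (induction k)
    case (Suc k)
    show ?case unfolding Ts_Suc
    proof (rule add_rank_one_invariant[OF Suc])
      show "e k *\<^sub>R (f k o\<^sub>L Ts k) \<in> dual sX"
        using f(1)[of k] Suc by (simp add: dual_iff invariant_operators_def ops_iff blinfun.scaleR_left)
      show "(e k *\<^sub>R (f k o\<^sub>L Ts k)) (blinfun_apply g x) = (e k *\<^sub>R (f k o\<^sub>L Ts k)) x" if "g \<in> G" for g x
        using Suc that by (simp add: invariant_operators_def blinfun.scaleR_left)
      show "h (z k) = z k" if "h \<in> H" for h
        using Suc that by (simp add: invariant_operators_def z_def)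
    qed
  qed (simp add: Ts_0 T)
  have step_le: "norm (Ts (Suc k) - Ts k) \<le> e k * (norm (Ts k))\<^sup>2" for k
  proof -
    have "norm (Ts (Suc k) - Ts k) \<le> norm (e k *\<^sub>R (f k o\<^sub>L Ts k)) * norm (z k)"
      unfolding Ts_Suc by (simp only: add_diff_cancel_left' Y.norm_rank_one_le)
    also have "\<dots> \<le> (e k * norm (Ts k)) * norm (Ts k)"
      using e_pos[of k] fT_le[of k] z_le[of k] by (intro mult_mono) auto
    finally show ?thesis by (simp add: power2_eq_square)
  qed
  have step_le4: "norm (Ts (Suc k) - Ts k) \<le> 4 * e k" if "norm (Ts k) \<le> 2" for k
  proof -
    have "(norm (Ts k))\<^sup>2 \<le> 2\<^sup>2" using that by (intro power_mono) auto
    then have "e k * (norm (Ts k))\<^sup>2 \<le> e k * 2\<^sup>2" using e_pos[of k] by (intro mult_left_mono) auto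
    then show ?thesis using step_le[of k] by simp
  qed
  \<comment> \<open>The bounds \<open>4 * e j\<close> on the steps with \<open>j \<ge> k\<close> add
      up to at most \<open>8 * e k\<close>, so this form telescopes without summation.\<close>
  have norm_le: "norm (Ts k) \<le> 2 - 8 * e k" for k
  proof (induction k)
    case 0
    show ?case using a by (simp add: Ts_0 T e_0)
  next
    case (Suc k)
    then have "norm (Ts (Suc k) - Ts k) \<le> 4 * e k" using e_pos[of k] by (intro step_le4) simp
    then have "norm (Ts (Suc k)) \<le> norm (Ts k) + 4 * e k"
      using norm_triangle_ineq2[of "Ts (Suc k)" "Ts k"] by simp
    then show ?case using Suc e_16[of k] e_pos[of k] by simp
  qed
  have step4: "norm (Ts (Suc k) - Ts k) \<le> 4 * e k" for k
    using norm_le[of k] e_pos[of k] by (intro step_le4) simp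
  have dist: "norm (Ts (k + i) - Ts k) \<le> 8 * e k - 8 * e (k + i)" for k i
  proof (induction i)
    case (Suc i)
    have "norm (Ts (k + Suc i) - Ts k) \<le> norm (Ts (Suc (k + i)) - Ts (k + i)) + norm (Ts (k + i) - Ts k)"
      using norm_triangle_ineq[of "Ts (Suc (k + i)) - Ts (k + i)" "Ts (k + i) - Ts k"] by simp
    then show ?case using Suc step4[of "k + i"] e_16[of "k + i"] e_pos[of "k + i"] by simp
  qed simp
  have dist8: "norm (Ts j - Ts k) \<le> 8 * e k" if "k \<le> j" for j k
    using dist[of k "j - k"] e_pos[of j] that by simp
  have "Cauchy Ts"
  proof (rule metric_CauchyI)
    fix r :: real assume r: "r > 0"
    obtain n where n: "(1/2) ^ n < r" using real_arch_pow_inv[of r "1/2"] r by auto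
    have "8 * e n \<le> (1/2) ^ n / 2"
      using e_le[of n] a divide_right_mono[of a "1/16" "2 ^ n"] by (simp add: power_divide)
    then have "dist (Ts m) (Ts n) < r / 2" if "m \<ge> n" for m
      using dist8[OF that] n by (simp add: dist_norm)
    then show "\<exists>M. \<forall>m\<ge>M. \<forall>n\<ge>M. dist (Ts m) (Ts n) < r"
      by (meson dist_triangle_half_l)
  qed
  then obtain S where S: "Ts \<longlonglongrightarrow> S" by (auto simp: Cauchy_convergent_iff convergent_def)
  have S_inv: "S \<in> inv_set" using closed_sequentially[OF closed_invariant inv S] .
  have S_dist: "norm (S - Ts k) \<le> 8 * e k" for k
  proof (rule Lim_bounded)
    show "(\<lambda>j. norm (Ts j - Ts k)) \<longlonglongrightarrow> norm (S - Ts k)" by (intro tendsto_intros S)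
    show "\<forall>j\<ge>k. norm (Ts j - Ts k) \<le> 8 * e k" using dist8 by blast
  qed
  have norm_Suc: "norm (z k) + e k * (norm (z k))\<^sup>2 \<le> norm (Ts (Suc k))" for k
  proof -
    have "Ts (Suc k) (x k) = z k + sY (of_real (e k * norm (z k))) (z k)"
      using f(2)[of k] by (simp add: Ts_Suc blinfun.add_left Y.rank_one_apply blinfun.scaleR_left
          z_def[symmetric] scaleR_conv_of_real)
    then have "Ts (Suc k) (x k) = (1 + e k * norm (z k)) *\<^sub>R z k"
      by (simp only: Y.scale_of_real) (simp add: scaleR_add_left)
    then have "norm (Ts (Suc k) (x k)) = (1 + e k * norm (z k)) * norm (z k)"
      using e_pos[of k] by (simp add: add_nonneg_nonneg)
    then show ?thesis using apply_le[of "Ts (Suc k)" k] by (simp add: power2_eq_square algebra_simps)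
  qed
  have grow: "norm (Ts k) \<le> norm (Ts (Suc k)) \<and> 1 \<le> norm (Ts k)" for k
  proof -
    have *: "norm (Ts k) \<le> norm (Ts (Suc k))" if "1 \<le> norm (Ts k)" for k
    proof -
      have "1 / 2 \<le> norm (z k)" using z_ge[of k] that e_le_a[of "Suc k"] a by simp
      then have "(1 / 2)\<^sup>2 \<le> (norm (z k))\<^sup>2" by (intro power_mono) auto
      then have "e k * (1 / 2)\<^sup>2 \<le> e k * (norm (z k))\<^sup>2" using e_pos[of k] by (intro mult_left_mono) auto
      moreover have "e k * (1 / 2)\<^sup>2 = e k / 4" by (simp add: power_divide)
      ultimately show ?thesis using norm_Suc[of k] z_ge[of k] e_16[of k] e_pos[of k] by linarith
    qed
    have "1 \<le> norm (Ts k)" for k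
    proof (induction k)
      case (Suc k)
      then show ?case using *[of k] by simp
    qed (simp add: Ts_0 T)
    then show ?thesis using *[of k] by simp
  qed
  have mono: "norm (Ts k) \<le> norm (Ts j)" if "k \<le> j" for k j
    using incseqD[OF incseq_SucI[of "\<lambda>k. norm (Ts k)", OF conjunct1[OF grow]] that] .
  have key: "norm (Ts k) - (2 * e (Suc k) + 10 / 2 ^ (k + 4)) \<le> norm (f j (z k))" if kj: "k < j" for k j
  proof -
    define n where "n = norm (Ts k)"
    define p where "p = norm (f j (z k))"
    define q :: real where "q = 10 / 2 ^ (k + 4)"
    have n1: "1 \<le> n" unfolding n_def by (rule conjunct2[OF grow])
    have expand: "f j (z j) = f j ((Ts j - Ts (Suc k)) (x j)) + f j (Ts k (x j)) + e k *\<^sub>R (f k (Ts k (x j)) * f j (z k))"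
    proof -
      have "f j (z j) = f j ((Ts j - Ts (Suc k)) (x j)) + f j (Ts (Suc k) (x j))"
        by (simp add: z_def blinfun.diff_left blinfun.diff_right)
      moreover have "Ts (Suc k) (x j) = Ts k (x j) + sY (e k *\<^sub>R f k (Ts k (x j))) (z k)"
        by (simp add: Ts_Suc blinfun.add_left Y.rank_one_apply blinfun.scaleR_left)
      ultimately show ?thesis
        using f(1)[of j] by (simp add: blinfun.add_right dual_iff)
    qed
    have "norm (f j (z j)) \<le> norm (f j ((Ts j - Ts (Suc k)) (x j))) + norm (f j (Ts k (x j)))
        + norm (e k *\<^sub>R (f k (Ts k (x j)) * f j (z k)))"
      unfolding expand by (intro norm_triangle_le add_right_mono norm_triangle_ineq)
    moreover have "norm (f j ((Ts j - Ts (Suc k)) (x j))) \<le> 8 * e (Suc k)"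
      using f1[of j "(Ts j - Ts (Suc k)) (x j)"] apply_le[of "Ts j - Ts (Suc k)" j] dist8[of "Suc k" j] kj by simp
    moreover have "norm (f j (Ts k (x j))) \<le> n"
      using f1[of j "Ts k (x j)"] apply_le[of "Ts k" j] by (simp add: n_def)
    moreover have "norm (e k *\<^sub>R (f k (Ts k (x j)) * f j (z k))) \<le> e k * (n * p)"
    proof -
      have "norm (f k (Ts k (x j))) \<le> n"
        using f1[of k "Ts k (x j)"] apply_le[of "Ts k" j] by (simp add: n_def)
      then have "norm (f k (Ts k (x j))) * p \<le> n * p" by (intro mult_right_mono) (simp_all add: p_def)
      then show ?thesis using e_pos[of k] by (simp add: norm_mult p_def)
    qed
    moreover have "norm (f j (z j)) = norm (z j)" using f(2)[of j] by simp
    ultimately have upper: "norm (z j) \<le> 8 * e (Suc k) + n + e k * (n * p)" by linarith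
    have "n - e (Suc k) \<ge> 0" using n1 e_le_a[of "Suc k"] a by simp
    have zk: "n - e (Suc k) \<le> norm (z k)" using z_ge[of k] by (simp add: n_def)
    then have "(n - e (Suc k))\<^sup>2 \<le> (norm (z k))\<^sup>2" using \<open>n - e (Suc k) \<ge> 0\<close> by (intro power_mono)
    moreover have "n\<^sup>2 - 2 * n * e (Suc k) \<le> (n - e (Suc k))\<^sup>2" by (simp add: power2_diff)
    ultimately have "e k * (n\<^sup>2 - 2 * n * e (Suc k)) \<le> e k * (norm (z k))\<^sup>2"
      using e_pos[of k] by (intro mult_left_mono) auto
    then have "n - e (Suc k) + e k * (n\<^sup>2 - 2 * n * e (Suc k)) \<le> norm (Ts (Suc k))"
      using norm_Suc[of k] zk by linarith
    moreover have "norm (Ts (Suc k)) \<le> norm (Ts j)" using kj by (intro mono) simp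
    moreover have "norm (Ts j) - e (Suc k) \<le> norm (z j)"
    proof -
      have "decseq e" using e_Suc_le by (rule decseq_SucI)
      from decseqD[OF this, of "Suc k" "Suc j"] kj have "e (Suc j) \<le> e (Suc k)" by simp
      then show ?thesis using z_ge[of j] by simp
    qed
    ultimately have "e k * (n\<^sup>2 - 2 * n * e (Suc k)) - 10 * e (Suc k) \<le> e k * (n * p)"
      using upper by linarith
    moreover have "10 * e (Suc k) = e k * q" by (simp add: e_Suc q_def)
    moreover have "e k * (n\<^sup>2 - 2 * n * e (Suc k) - q) = e k * (n\<^sup>2 - 2 * n * e (Suc k)) - e k * q"
      by (rule right_diff_distrib)
    ultimately have "e k * (n\<^sup>2 - 2 * n * e (Suc k) - q) \<le> e k * (n * p)" by linarith
    then have "n\<^sup>2 - 2 * n * e (Suc k) - q \<le> n * p" using e_pos[of k] by (rule mult_left_le_imp_le)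
    moreover have "q \<le> n * q" using mult_right_mono[OF n1, of q] by (simp add: q_def)
    moreover have "n * (n - (2 * e (Suc k) + q)) = n\<^sup>2 - 2 * n * e (Suc k) - n * q"
      by (simp add: power2_eq_square right_diff_distrib distrib_left)
    ultimately have "n * (n - (2 * e (Suc k) + q)) \<le> n * p" by linarith
    then have "n - (2 * e (Suc k) + q) \<le> p" by (rule mult_left_le_imp_le) (use n1 in simp)
    then show ?thesis by (simp only: n_def p_def q_def)
  qed
  have "norm S - 2 / 2 ^ k \<le> norm (f j (S (x k)))" if "k < j" for k j
  proof -
    have "norm (f j (z k)) \<le> norm (f j (S (x k))) + norm (f j ((S - Ts k) (x k)))"
      using norm_triangle_ineq4[of "f j (S (x k))" "f j ((S - Ts k) (x k))"]
      by (simp add: blinfun.diff_left blinfun.diff_right z_def)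
    moreover have "norm (f j ((S - Ts k) (x k))) \<le> 8 * e k"
      using f1[of j "(S - Ts k) (x k)"] apply_le[of "S - Ts k" k] S_dist[of k] by simp
    moreover have "norm S \<le> norm (Ts k) + 8 * e k"
      using norm_triangle_ineq2[of S "Ts k"] S_dist[of k] by simp
    moreover have "16 * e k + 2 * e (Suc k) + 10 / 2 ^ (k + 4) \<le> 2 / 2 ^ k"
    proof -
      define w :: real where "w = 1 / 2 ^ k"
      have "e k \<le> w / 16"
        using e_le[of k] a divide_right_mono[of a "1/16" "2 ^ k"] by (simp add: w_def)
      moreover have "10 / 2 ^ (k + 4) = 10 / 16 * w" "2 / 2 ^ k = 2 * w" by (simp_all add: w_def power_add)
      ultimately show ?thesis using e_16[of k] e_pos[of k] by linarith
    qed
    ultimately show ?thesis using key[OF that] by linarith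
  qed
  moreover have "norm (S - T) \<le> \<epsilon>" using S_dist[of 0] a by (simp add: Ts_0 e_0)
  ultimately show ?thesis
    using f(1) by (intro that[of S x] S_inv x) blast+
qed

end

section \<open>Norming a sequence by an extreme functional\<close>

lemma pointwise_convergent_subsequence:
  fixes a :: "nat \<Rightarrow> nat \<Rightarrow> 'a::heine_borel"
  assumes "\<And>k. bounded (range (\<lambda>j. a j k))"
  obtains r l where "strict_mono (r :: nat \<Rightarrow> nat)" "\<And>k. (\<lambda>j. a (r j) k) \<longlonglongrightarrow> l k"
proof -
  define K where "K = (\<Pi>\<^sub>E k\<in>UNIV. closure (range (\<lambda>j. a j k)))"
  have "compactin (product_topology (\<lambda>_. euclidean) UNIV) K"
    unfolding K_def using assms by (subst compactin_PiE) (simp add: compact_closure)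
  then have "seq_compact K" by (simp add: euclidean_product_topology compact_eq_seq_compact_metric)
  moreover have "\<forall>j. a j \<in> K" unfolding K_def using closure_subset by fastforce
  ultimately obtain l r where "strict_mono (r :: nat \<Rightarrow> nat)" and l: "(a \<circ> r) \<longlonglongrightarrow> l"
    by (rule seq_compactE)
  moreover have "(\<lambda>j. a (r j) k) \<longlonglongrightarrow> l k" for k
  proof -
    have "continuous_on UNIV (\<lambda>b :: nat \<Rightarrow> 'a. b k)"
      by (rule continuous_on_product_then_coordinatewise[OF continuous_on_id])
    from continuous_on_tendsto_compose[OF this l] show ?thesis by (simp add: o_def)
  qed
  ultimately show ?thesis using that by blast
qed

lemma closed_range_to_complex: "closed (range (to_complex :: 'k::real_or_complex \<Rightarrow> complex))"
  using range_to_complex[where 'k = 'k] closed_complex_Reals by auto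

context banach_over
begin

text \<open>
  The functionals \<open>f\<close> in the hypothesis depend on \<open>j\<close>, and so do the phases of \<open>f (v k)\<close>. Along a subsequence the
  values converge for every \<open>k\<close>; rotating \<open>v k\<close> by the phase of the limit makes the real parts of finitely many
  values almost as large as their moduli. Adding them up, the partial sums of the rotated vectors have norm at least
  \<open>K - c - 1\<close>, as \<open>extreme_functional_along_sequence\<close> requires.
\<close>

theorem extreme_functional_norming_sequence:
  fixes v :: "nat \<Rightarrow> 'a" and b :: "nat \<Rightarrow> real"
  assumes v: "\<And>k. norm (v k) \<le> 1"
    and f: "\<And>j. \<exists>f\<in>dual scale \<inter> cball 0 1. \<forall>k<j. 1 - b k \<le> norm (blinfun_apply f (v k))"
    and b: "\<And>K. (\<Sum>k<K. b k) \<le> c"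
  obtains e :: "'a \<Rightarrow>\<^sub>L 'k" where "e extreme_point_of (dual scale \<inter> cball 0 1)"
    "\<And>\<delta>. \<delta> > 0 \<Longrightarrow> \<exists>k. norm (e (v k)) > 1 - \<delta>"
proof -
  obtain F :: "nat \<Rightarrow> 'a \<Rightarrow>\<^sub>L 'k" where F: "\<And>j. F j \<in> dual scale \<inter> cball 0 1"
    "\<And>j k. k < j \<Longrightarrow> 1 - b k \<le> norm (F j (v k))" using f by metis
  have F_le: "norm (F j y) \<le> norm y" for j y by (rule dual_unit_ball_le[OF F(1)])
  have "bounded (range (\<lambda>j. to_complex (F j (v k))))" for k
    using F_le[of _ "v k"] by (intro boundedI[of _ "norm (v k)"]) (auto simp: norm_to_complex)
  from pointwise_convergent_subsequence[of "\<lambda>j k. to_complex (F j (v k))", OF this]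
  obtain r l where r: "strict_mono (r :: nat \<Rightarrow> nat)" "\<And>k. (\<lambda>j. to_complex (F (r j) (v k))) \<longlonglongrightarrow> l k"
    by blast
  have "l k \<in> range (to_complex :: 'k \<Rightarrow> complex)" for k
    using closed_sequentially[OF closed_range_to_complex _ r(2)] by blast
  then have "\<exists>\<alpha> :: 'k. to_complex \<alpha> = l k" for k by (metis imageE)
  then obtain \<alpha> :: "nat \<Rightarrow> 'k" where \<alpha>: "\<And>k. to_complex (\<alpha> k) = l k" by metis
  have "\<exists>u. norm u = 1 \<and> u * \<alpha> k = of_real (norm (\<alpha> k))" for k by (metis exists_rotation)
  then obtain u where u: "\<And>k. norm (u k) = 1" "\<And>k. u k * \<alpha> k = of_real (norm (\<alpha> k))" by metis
  have near: "\<exists>j\<ge>K. \<forall>k<K. norm (F j (v k) - \<alpha> k) < \<eta>" if "\<eta> > 0" for K \<eta>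
  proof -
    have "\<forall>\<^sub>F j in sequentially. \<forall>k\<in>{..<K}. dist (to_complex (F (r j) (v k))) (l k) < \<eta>"
      using r(2) \<open>\<eta> > 0\<close> by (intro eventually_ball_finite) (auto simp: tendsto_iff)
    moreover have "\<forall>\<^sub>F j in sequentially. K \<le> j" by (rule eventually_ge_at_top)
    ultimately have "\<forall>\<^sub>F j in sequentially. K \<le> j \<and> (\<forall>k\<in>{..<K}. dist (to_complex (F (r j) (v k))) (l k) < \<eta>)"
      by (simp add: eventually_conj_iff)
    then obtain j where j: "K \<le> j" "\<forall>k\<in>{..<K}. dist (to_complex (F (r j) (v k))) (l k) < \<eta>"
      by (auto dest: eventually_happens)
    have "norm (F (r j) (v k) - \<alpha> k) < \<eta>" if "k < K" for k
    proof -
      have "norm (F (r j) (v k) - \<alpha> k) = norm (to_complex (F (r j) (v k) - \<alpha> k))"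
        by (rule norm_to_complex[symmetric])
      also have "\<dots> < \<eta>" using j(2) that by (simp only: to_complex_diff \<alpha> dist_norm) simp
      finally show ?thesis .
    qed
    moreover have "K \<le> r j" using j(1) seq_suble[OF r(1), of j] by simp
    ultimately show ?thesis by blast
  qed
  define w where "w k = scale (u k) (v k)" for k
  have w: "norm (w k) \<le> 1" for k using v by (simp add: w_def norm_scale u)
  have "real K - norm (\<Sum>k<K. w k) \<le> c + 1" for K
  proof -
    define \<eta> where "\<eta> = 1 / (2 * real K + 1)"
    have \<eta>: "\<eta> > 0" "real K * (2 * \<eta>) \<le> 1" by (auto simp: \<eta>_def field_simps)
    obtain j where j: "K \<le> j" "\<And>k. k < K \<Longrightarrow> norm (F j (v k) - \<alpha> k) < \<eta>" using near[OF \<eta>(1)] by blast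
    have "1 - b k - 2 * \<eta> \<le> re_part (F j (w k))" if k: "k < K" for k
    proof -
      have "F j (w k) = of_real (norm (\<alpha> k)) + u k * (F j (v k) - \<alpha> k)"
        using F(1)[of j] by (simp add: w_def dual_iff right_diff_distrib u(2))
      then have "re_part (F j (w k)) = norm (\<alpha> k) + re_part (u k * (F j (v k) - \<alpha> k))"
        by (simp add: linear_add[OF linear_re_part] re_part_of_real)
      moreover have "- re_part (u k * (F j (v k) - \<alpha> k)) \<le> norm (F j (v k) - \<alpha> k)"
        using re_part_le_norm[of "- (u k * (F j (v k) - \<alpha> k))"]
        by (simp add: linear_neg[OF linear_re_part] norm_mult u(1))
      moreover have "norm (F j (v k)) - norm (\<alpha> k) \<le> norm (F j (v k) - \<alpha> k)" by (rule norm_triangle_ineq2)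
      moreover have "1 - b k \<le> norm (F j (v k))" using F(2) k j(1) by simp
      ultimately show ?thesis using j(2)[OF k] by linarith
    qed
    then have "(\<Sum>k<K. 1 - b k - 2 * \<eta>) \<le> (\<Sum>k<K. re_part (F j (w k)))" by (intro sum_mono) auto
    also have "\<dots> = re_part (F j (\<Sum>k<K. w k))" by (rule linear_sum[OF linear_re_dual, symmetric])
    also have "\<dots> \<le> norm (\<Sum>k<K. w k)" by (rule dual_unit_ball_le[OF F(1)])
    finally have "real K - (\<Sum>k<K. b k) - real K * (2 * \<eta>) \<le> norm (\<Sum>k<K. w k)"
      by (simp add: sum_subtractf)
    then show ?thesis using b[of K] \<eta>(2) by linarith
  qed
  from extreme_functional_along_sequence[OF w this]
  obtain e :: "'a \<Rightarrow>\<^sub>L 'k" where e: "e extreme_point_of (dual scale \<inter> cball 0 1)"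
    "\<And>\<delta>. \<delta> > 0 \<Longrightarrow> \<exists>k. re_part (e (w k)) > 1 - \<delta>" by blast
  have "re_part (e (w k)) \<le> norm (e (v k))" for k
    using re_part_le_norm[of "e (w k)"] e(1) by (simp add: w_def dual_iff extreme_point_of_def norm_mult u(1))
  then have "\<exists>k. norm (e (v k)) > 1 - \<delta>" if "\<delta> > 0" for \<delta>
    using e(2)[OF that] by (meson less_le_trans)
  with that e(1) show ?thesis by blast
qed

end

section \<open>Property quasi-beta and density\<close>

lemma weak_star_closure_approx:
  assumes "f \<in> weak_star sY closure_of A" and \<delta>: "\<delta> > 0"
  obtains g where "g \<in> A" "norm (blinfun_apply g y - blinfun_apply f y) < \<delta>"
proof -
  define U where "U = {g. blinfun_apply g y \<in> ball (blinfun_apply f y) \<delta>} \<inter> dual sY"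
  have "openin strong_operator_topology {g \<in> topspace strong_operator_topology. blinfun_apply g y \<in> ball (blinfun_apply f y) \<delta>}"
    by (rule openin_continuous_map_preimage[OF strong_operator_topology_continuous_evaluation]) simp
  then have "openin (weak_star sY) U"
    unfolding weak_star_def openin_subtopology U_def by (auto simp: strong_operator_topology_topspace)
  moreover have "f \<in> U"
    using assms by (auto simp: U_def in_closure_of weak_star_def)
  ultimately obtain g where "g \<in> A" "g \<in> U" using assms(1) unfolding in_closure_of by blast
  then show ?thesis using that by (auto simp: U_def dist_norm norm_minus_commute)
qed

context banach_over
begin

text \<open>
  The form in which (iv) is used. The number \<open>r\<close> is the supremum of \<open>\<rho>\<close> over the set given by (iv), raised
  to \<open>0\<close> if it is negative; that supremum is genuine, as (iii) bounds \<open>\<rho>\<close> when there are two indices, and otherwise the set is finite.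
\<close>

lemma quasi_beta_extreme:
  assumes qb: "quasi_beta_family scale H \<Lambda> y ys \<rho>"
    and e: "e extreme_point_of (dual scale \<inter> cball 0 1)"
  obtains r where "0 \<le> r" "r < 1"
    "\<And>v \<delta>. \<delta> > 0 \<Longrightarrow> \<exists>i\<in>\<Lambda>. \<exists>h\<in>H. \<rho> (ys i) \<le> r \<and> norm (blinfun_apply e v) - \<delta> < norm (blinfun_apply (ys i) (blinfun_apply h v))"
proof -
  obtain B t where B: "B \<subseteq> ys ` \<Lambda>" and t: "norm t = 1"
    and cl: "dual_scale t e \<in> weak_star scale closure_of {adjoint_op h f | h f. h \<in> H \<and> f \<in> B}"
    and sup: "(SUP f\<in>B. \<rho> f) < 1"
    using qb[unfolded quasi_beta_family_def, THEN conjunct2, THEN conjunct2, THEN conjunct2, THEN conjunct2,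
        THEN conjunct2, rule_format, OF e] by auto
  have bdd: "bdd_above (\<rho> ` B)"
  proof (cases "\<exists>i\<in>\<Lambda>. \<exists>j\<in>\<Lambda>. i \<noteq> j")
    case True
    then have other: "\<exists>j\<in>\<Lambda>. i \<noteq> j" if "i \<in> \<Lambda>" for i using that by metis
    have "\<rho> (ys i) \<le> 1" if i: "i \<in> \<Lambda>" for i
    proof -
      obtain j where "j \<in> \<Lambda>" "i \<noteq> j" using other[OF i] by blast
      then have "\<rho> (ys i) < 1" using qb i unfolding quasi_beta_family_def by blast
      then show ?thesis by simp
    qed
    then show ?thesis using B by (intro bdd_aboveI2[of _ _ 1]) auto
  next
    case False
    then have "\<Lambda> = {} \<or> (\<exists>i. \<Lambda> = {i})" by blast
    then have "finite \<Lambda>" by auto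
    then show ?thesis using finite_subset[OF B] by simp
  qed
  define r where "r = max 0 (SUP f\<in>B. \<rho> f)"
  have "\<exists>i\<in>\<Lambda>. \<exists>h\<in>H. \<rho> (ys i) \<le> r \<and> norm (e v) - \<delta> < norm (blinfun_apply (ys i) (blinfun_apply h v))" if \<delta>: "\<delta> > 0" for v \<delta>
  proof -
    obtain g where "g \<in> {adjoint_op h f | h f. h \<in> H \<and> f \<in> B}" and g: "norm (g v - dual_scale t e v) < \<delta>"
      using weak_star_closure_approx[OF cl \<delta>] by blast
    then obtain h f where hf: "h \<in> H" "f \<in> B" "g = adjoint_op h f" by blast
    then obtain i where i: "i \<in> \<Lambda>" "f = ys i" using B by blast
    have "\<rho> f \<le> r" using cSUP_upper[OF hf(2) bdd] by (simp add: r_def)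
    moreover have "norm (e v) = norm (dual_scale t e v)" by (simp add: dual_scale_def norm_mult t)
    then have "norm (e v) - norm (g v) \<le> norm (dual_scale t e v - g v)"
      using norm_triangle_ineq2[of "dual_scale t e v" "g v"] by simp
    moreover have "norm (dual_scale t e v - g v) < \<delta>" using g by (simp add: norm_minus_commute)
    moreover have "g v = ys i (h v)" by (simp add: hf(3) i(2) adjoint_op_def)
    ultimately have "\<rho> (ys i) \<le> r \<and> norm (e v) - \<delta> < norm (ys i (h v))" using i(2) by simp
    then show ?thesis using i(1) hf(1) by blast
  qed
  with that[of r] sup show ?thesis by (auto simp: r_def)
qed

lemma quasi_beta_norming:
  assumes qb: "quasi_beta_family scale H \<Lambda> y ys \<rho>" and \<delta>: "\<delta> > 0"
  shows "\<exists>i\<in>\<Lambda>. \<exists>h\<in>H. norm v - \<delta> < norm (blinfun_apply (ys i) (blinfun_apply h v))"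
proof -
  obtain e :: "'a \<Rightarrow>\<^sub>L 'k" where e: "e extreme_point_of (dual scale \<inter> cball 0 1)" "e v = of_real (norm v)"
    by (rule extreme_norming_functional)
  obtain r where "\<exists>i\<in>\<Lambda>. \<exists>h\<in>H. \<rho> (ys i) \<le> r \<and> norm (blinfun_apply e v) - \<delta> < norm (blinfun_apply (ys i) (blinfun_apply h v))"
    using quasi_beta_extreme[OF qb e(1)] \<delta> by metis
  then show ?thesis using e(2) by auto
qed

end

lemma norm_attaining_scaleR: "norm_attaining T \<Longrightarrow> norm_attaining (r *\<^sub>R T)"
  by (auto simp: norm_attaining_def blinfun.scaleR_left)

context banach_over_pair
begin

lemma norm_le_if_quasi_beta:
  assumes qb: "quasi_beta_family sY H \<Lambda> y ys \<rho>" and R: "R \<in> inv_set" and M: "0 \<le> M"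
    and le: "\<And>i x. i \<in> \<Lambda> \<Longrightarrow> norm (blinfun_apply (ys i) (R x)) \<le> M * norm x"
  shows "norm R \<le> M"
proof (rule norm_blinfun_bound[OF M], rule field_le_epsilon)
  fix x and \<delta> :: real assume "\<delta> > 0"
  from Y.quasi_beta_norming[OF qb this, of "R x"]
  obtain i h where ih: "i \<in> \<Lambda>" "h \<in> H" and lt: "norm (R x) - \<delta> < norm (blinfun_apply (ys i) (h (R x)))" by blast
  have "h (R x) = R x" using R ih(2) by (simp add: invariant_operators_def)
  then show "norm (R x) \<le> M * norm x + \<delta>" using lt le[OF ih(1), of x] by simp
qed

text \<open>
  The operator \<open>R\<close> replaces \<open>ys i \<circ> S\<close> by \<open>(1 + \<eta>) z\<close> and moves values in the direction of \<open>y i\<close> only. The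
  hypothesis \<open>large\<close> states that even so the other components \<open>ys j \<circ> R\<close> are bounded by the norm of \<open>(1 + \<eta>) z\<close>.
  The components determine the norm of \<open>R\<close> because \<open>R\<close> takes its values in the fixed vectors of \<open>H\<close>.
\<close>

lemma norm_attaining_rank_one_perturbation:
  assumes qb: "quasi_beta_family sY H \<Lambda> y ys \<rho>" and S: "S \<in> inv_set" and i: "i \<in> \<Lambda>"
    and r: "\<rho> (ys i) \<le> r" "0 \<le> r" and \<eta>: "0 < \<eta>" and \<delta>: "0 \<le> \<delta>"
    and z: "z \<in> dual sX" "\<And>g x. g \<in> G \<Longrightarrow> z (blinfun_apply g x) = z x"
      "norm (z - (ys i o\<^sub>L S)) \<le> \<delta>" "norm x0 \<le> 1" "norm (z x0) = norm z"
    and large: "norm S + r * (\<eta> * norm z + \<delta>) \<le> (1 + \<eta>) * norm z"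
  obtains R where "R \<in> inv_set" "norm_attaining R" "norm (R - S) \<le> \<eta> * norm z + \<delta>"
proof -
  let ?xs = "ys i o\<^sub>L S"
  define \<phi> where "\<phi> = (1 + \<eta>) *\<^sub>R z - ?xs"
  define R where "R = S + rank_one sY \<phi> (y i)"
  have y: "norm (y j) = 1" and ys: "ys j \<in> dual sY" "norm (ys j) = 1"
    and hy: "\<And>h. h \<in> H \<Longrightarrow> blinfun_apply h (y j) = y j" and yy: "blinfun_apply (ys j) (y j) = 1" if "j \<in> \<Lambda>" for j
    using qb that unfolding quasi_beta_family_def by auto
  have yj: "norm (blinfun_apply (ys j) (y i)) \<le> r" if "j \<in> \<Lambda>" "j \<noteq> i" for j
    using qb that i r(1) unfolding quasi_beta_family_def by (metis order_trans)
  have xs: "?xs \<in> dual sX" using ys(1)[OF i] S by (simp add: dual_iff ops_iff invariant_operators_def)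
  have \<phi>: "\<phi> \<in> dual sX"
    using z(1) xs by (simp add: \<phi>_def dual_iff blinfun.diff_left blinfun.scaleR_left right_diff_distrib)
  have "\<phi> (blinfun_apply g x) = \<phi> x" if "g \<in> G" for g x
    using z(2) that S by (simp add: \<phi>_def blinfun.diff_left blinfun.scaleR_left invariant_operators_def)
  then have R: "R \<in> inv_set"
    unfolding R_def using hy[OF i] by (intro add_rank_one_invariant S \<phi>)
  have norm_\<phi>: "norm \<phi> \<le> \<eta> * norm z + \<delta>"
  proof -
    have "\<phi> = \<eta> *\<^sub>R z + (z - ?xs)" by (simp add: \<phi>_def algebra_simps)
    then have "norm \<phi> \<le> norm (\<eta> *\<^sub>R z) + norm (z - ?xs)" by (simp only: norm_triangle_ineq)
    then show ?thesis using z(3) \<eta> by simp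
  qed
  have "norm (R - S) \<le> norm \<phi> * norm (y i)"
    unfolding R_def by (simp only: add_diff_cancel_left' Y.norm_rank_one_le)
  then have near: "norm (R - S) \<le> \<eta> * norm z + \<delta>" using norm_\<phi> y[OF i] by simp
  have apply_R: "ys j (R x) = ys j (S x) + \<phi> x * ys j (y i)" if "j \<in> \<Lambda>" for j x
    using ys(1)[OF that] by (simp add: R_def blinfun.add_left blinfun.add_right Y.rank_one_apply dual_iff)
  have apply_i: "ys i (R x) = (1 + \<eta>) *\<^sub>R z x" for x
    using apply_R[OF i] yy[OF i] by (simp add: \<phi>_def blinfun.diff_left blinfun.scaleR_left)
  have "norm R \<le> (1 + \<eta>) * norm z"
  proof (rule norm_le_if_quasi_beta[OF qb R])
    show "0 \<le> (1 + \<eta>) * norm z" using \<eta> by simp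
    fix j x assume j: "j \<in> \<Lambda>"
    show "norm (ys j (R x)) \<le> (1 + \<eta>) * norm z * norm x"
    proof (cases "j = i")
      case True
      then show ?thesis using \<eta> norm_blinfun[of z x] by (simp add: apply_i)
    next
      case False
      have "norm (ys j (S x)) \<le> norm (ys j) * norm (S x)" by (rule norm_blinfun)
      also have "\<dots> \<le> norm S * norm x" using ys(2)[OF j] norm_blinfun[of S x] by simp
      finally have 1: "norm (ys j (S x)) \<le> norm S * norm x" .
      have "norm (\<phi> x) \<le> norm \<phi> * norm x" by (rule norm_blinfun)
      also have "\<dots> \<le> (\<eta> * norm z + \<delta>) * norm x" using norm_\<phi> by (rule mult_right_mono) simp
      finally have "norm (\<phi> x) * norm (ys j (y i)) \<le> ((\<eta> * norm z + \<delta>) * norm x) * r"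
        using yj[OF j False] \<eta> \<delta> by (intro mult_mono) auto
      then have "norm (ys j (R x)) \<le> norm S * norm x + ((\<eta> * norm z + \<delta>) * norm x) * r"
        using 1 norm_triangle_ineq[of "ys j (S x)" "\<phi> x * ys j (y i)"] by (simp add: apply_R[OF j] norm_mult)
      also have "\<dots> = (norm S + r * (\<eta> * norm z + \<delta>)) * norm x" by (simp add: algebra_simps)
      also have "\<dots> \<le> (1 + \<eta>) * norm z * norm x" using large by (rule mult_right_mono) simp
      finally show ?thesis .
    qed
  qed
  moreover have "(1 + \<eta>) * norm z \<le> norm (R x0)"
    using norm_blinfun[of "ys i" "R x0"] ys(2)[OF i] z(5) \<eta> by (simp add: apply_i)
  moreover have "norm (R x0) \<le> norm R"
    using norm_blinfun[of R x0] mult_left_mono[OF z(4), of "norm R"] by simp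
  ultimately have "norm (R x0) = norm R" by linarith
  then have "norm_attaining R" using z(4) by (auto simp: norm_attaining_def)
  then show ?thesis using that R near by blast
qed

theorem norm_attaining_dense_unit:
  assumes qb: "quasi_beta_family sY H \<Lambda> y ys \<rho>"
    and G: "isometry_group sX G" "compact G"
    and T: "T \<in> inv_set" "norm T = 1" and \<epsilon>: "0 < \<epsilon>"
  obtains R where "R \<in> inv_set" "norm_attaining R" "norm (R - T) \<le> \<epsilon>"
proof -
  obtain S x where S: "S \<in> inv_set" and ST: "norm (S - T) \<le> min (\<epsilon> / 2) (1 / 2)" and x: "\<And>k. norm (x k) \<le> 1"
    and fS: "\<And>j. \<exists>f\<in>dual sY \<inter> cball 0 1. \<forall>k<j. norm S - 2 / 2 ^ k \<le> norm (blinfun_apply f (S (x k)))"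
    using lindenstrauss_iteration[OF T, of "min (\<epsilon> / 2) (1 / 2)"] \<epsilon> by auto
  define N where "N = norm S"
  have N: "1 / 2 \<le> N" "N \<le> 3 / 2"
    using norm_triangle_ineq2[of T S] norm_triangle_ineq2[of S T] ST T(2) by (auto simp: N_def norm_minus_commute)
  define v where "v k = (1 / N) *\<^sub>R S (x k)" for k
  have v1: "norm (v k) \<le> 1" for k
  proof -
    have "norm (S (x k)) \<le> N * 1"
      using norm_blinfun[of S "x k"] mult_left_mono[OF x[of k], of N] N by (simp add: N_def)
    then show ?thesis using N by (simp add: v_def)
  qed
  have f1: "\<exists>f\<in>dual sY \<inter> cball 0 1. \<forall>k<j. 1 - 4 / 2 ^ k \<le> norm (blinfun_apply f (v k))" for j
  proof -
    obtain f where f: "f \<in> dual sY \<inter> cball 0 1" "\<And>k. k < j \<Longrightarrow> N - 2 / 2 ^ k \<le> norm (blinfun_apply f (S (x k)))"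
      using fS[of j] by (auto simp: N_def)
    have "1 - 4 / 2 ^ k \<le> norm (blinfun_apply f (v k))" if "k < j" for k
    proof -
      define w :: real where "w = 2 / 2 ^ k"
      have "w / N \<le> w / (1 / 2)" using N by (intro divide_left_mono) (auto simp: w_def)
      then have "w / N \<le> 2 * w" by simp
      moreover have "(N - w) / N \<le> norm (blinfun_apply f (S (x k))) / N"
        using f(2)[OF that] N by (intro divide_right_mono) (auto simp: w_def)
      moreover have "(N - w) / N = 1 - w / N" using N by (simp add: diff_divide_distrib)
      moreover have "norm (blinfun_apply f (v k)) = norm (blinfun_apply f (S (x k))) / N"
        using N by (simp add: v_def blinfun.scaleR_right)
      ultimately have "1 - 2 * w \<le> norm (blinfun_apply f (v k))" by linarith
      then show ?thesis by (simp add: w_def)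
    qed
    with f(1) show ?thesis by blast
  qed
  have b: "(\<Sum>k<K. 4 / 2 ^ k :: real) \<le> 8" for K
  proof -
    have "(\<Sum>k<K. 4 / 2 ^ k :: real) = 8 - 8 / 2 ^ K" by (induction K) auto
    then show ?thesis by simp
  qed
  obtain e :: "'y \<Rightarrow>\<^sub>L 'k" where e: "e extreme_point_of (dual sY \<inter> cball 0 1)"
    "\<And>\<delta>. \<delta> > 0 \<Longrightarrow> \<exists>k. norm (e (v k)) > 1 - \<delta>"
    using Y.extreme_functional_norming_sequence[OF v1 f1 b] by blast
  obtain r where r: "0 \<le> r" "r < 1" and qe: "\<And>v \<delta>. \<delta> > 0 \<Longrightarrow>
      \<exists>i\<in>\<Lambda>. \<exists>h\<in>H. \<rho> (ys i) \<le> r \<and> norm (blinfun_apply e v) - \<delta> < norm (blinfun_apply (ys i) (blinfun_apply h v))"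
    using Y.quasi_beta_extreme[OF qb e(1)] by blast
  define \<eta> where "\<eta> = min (\<epsilon> / 8) 1"
  \<comment> \<open>The gain \<open>(1 - r) * \<eta> * norm z\<close> over the other components has
      to outweigh errors of at most \<open>3 * \<delta>\<close>, where \<open>norm z\<close> is at
      least \<open>1 / 4\<close>.\<close>
  define \<delta> where "\<delta> = (1 - r) * \<eta> / 12"
  have \<eta>: "0 < \<eta>" "\<eta> \<le> \<epsilon> / 8" "\<eta> \<le> 1" using \<epsilon> by (auto simp: \<eta>_def)
  have "(1 - r) * \<eta> \<le> 1 * \<eta>" using r \<eta> by (intro mult_right_mono) auto
  then have \<delta>: "0 < \<delta>" "\<delta> \<le> \<eta> / 12" using r \<eta> by (auto simp: \<delta>_def)
  obtain k where k: "norm (e (v k)) > 1 - \<delta> / 4" using e(2)[of "\<delta> / 4"] \<delta> by auto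
  obtain i h where i: "i \<in> \<Lambda>" "\<rho> (ys i) \<le> r" and h: "h \<in> H"
    and large: "norm (e (v k)) - \<delta> / 4 < norm (blinfun_apply (ys i) (blinfun_apply h (v k)))"
    using qe[of "\<delta> / 4" "v k"] \<delta> by auto
  have ys: "ys i \<in> dual sY" "norm (ys i) = 1" using qb i(1) unfolding quasi_beta_family_def by auto
  let ?xs = "ys i o\<^sub>L S"
  have "blinfun_apply h (v k) = v k"
    using S h by (simp add: v_def blinfun.scaleR_right invariant_operators_def)
  then have "1 - \<delta> / 2 < norm (?xs (x k)) / N"
    using k large N by (simp add: v_def blinfun.scaleR_right)
  then have "N * (1 - \<delta> / 2) < norm (?xs (x k))" using N by (simp add: field_simps)
  moreover have "norm (?xs (x k)) \<le> norm ?xs"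
    using norm_blinfun[of ?xs "x k"] mult_left_mono[OF x[of k], of "norm ?xs"] by simp
  moreover have "N * \<delta> \<le> 3 / 2 * \<delta>" using N \<delta> by (intro mult_right_mono) auto
  moreover have "N * (1 - \<delta> / 2) = N - N * \<delta> / 2" by (simp add: right_diff_distrib)
  ultimately have xs_ge: "N - \<delta> < norm ?xs" using \<delta> by linarith
  have xs_le: "norm ?xs \<le> N" using norm_blinfun_compose[of "ys i" S] ys(2) by (simp add: N_def)
  have xs: "?xs \<in> dual sX" using ys(1) S by (simp add: dual_iff ops_iff invariant_operators_def)
  have xs_inv: "\<forall>g\<in>G. \<forall>x. ?xs (blinfun_apply g x) = ?xs x" using S by (simp add: invariant_operators_def)
  obtain P where P: "P \<in> ops sX sX" "norm P \<le> 1" "\<And>x. P (P x) = P x"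
    "\<And>g x. g \<in> G \<Longrightarrow> P (blinfun_apply g x) = P x"
    "\<And>f :: 'x \<Rightarrow>\<^sub>L 'k. \<forall>g\<in>G. \<forall>x. f (blinfun_apply g x) = f x \<Longrightarrow> \<forall>x. f (P x) = f x"
    using X.invariant_projection[OF G] by blast
  obtain z x0 where z: "z \<in> dual sX" "\<And>x. z (P x) = z x" "norm (z - ?xs) \<le> \<delta>"
    "norm x0 \<le> 1" "norm (z x0) = norm z"
    using X.bishop_phelps_invariant[OF P(1) P(3) P(2) xs P(5)[OF xs_inv, rule_format] \<delta>(1)] by blast
  have z_inv: "z (blinfun_apply g x) = z x" if "g \<in> G" for g x
    using z(2) P(4)[OF that] by metis
  have z_le: "norm z \<le> N + \<delta>" and z_ge: "N - 2 * \<delta> \<le> norm z"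
    using z(3) xs_le xs_ge norm_triangle_ineq2[of z ?xs] norm_triangle_ineq2[of ?xs z]
    by (simp_all add: norm_minus_commute)
  have "norm S + r * (\<eta> * norm z + \<delta>) \<le> (1 + \<eta>) * norm z"
  proof -
    have "r * \<delta> \<le> \<delta>" using r \<delta> by (intro mult_left_le_one_le) auto
    moreover have "(1 - r) * \<eta> * (N - 2 * \<delta>) \<le> (1 - r) * \<eta> * norm z"
      using z_ge r \<eta> by (intro mult_left_mono) auto
    moreover have "12 * \<delta> * (1 / 4) \<le> (1 - r) * \<eta> * (N - 2 * \<delta>)"
    proof -
      have "12 * \<delta> * (1 / 4) \<le> 12 * \<delta> * (N - 2 * \<delta>)"
        using N \<delta> \<eta> by (intro mult_left_mono) auto
      then show ?thesis by (simp add: \<delta>_def)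
    qed
    moreover have "(1 - r) * \<eta> * norm z = \<eta> * norm z - r * (\<eta> * norm z)" by (simp add: algebra_simps)
    ultimately show ?thesis using z_ge by (simp add: N_def distrib_left distrib_right)
  qed
  from norm_attaining_rank_one_perturbation[OF qb S i r(1) \<eta>(1) less_imp_le[OF \<delta>(1)] z(1) z_inv z(3,4,5) this]
  obtain R where R: "R \<in> inv_set" "norm_attaining R" "norm (R - S) \<le> \<eta> * norm z + \<delta>" by blast
  have "\<eta> * norm z \<le> \<eta> * 2" using z_le N \<delta> \<eta> by (intro mult_left_mono) auto
  then have "norm (R - S) \<le> \<epsilon> / 2" using R(3) \<delta> \<eta> by linarith
  then have "norm (R - T) \<le> \<epsilon>"
    using norm_triangle_ineq[of "R - S" "S - T"] ST by simp
  with R that show ?thesis by blast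
qed

theorem norm_attaining_dense:
  assumes qb: "quasi_beta_family sY H \<Lambda> y ys \<rho>"
    and G: "isometry_group sX G" "compact G"
  shows "inv_set \<subseteq> closure {R \<in> inv_set. norm_attaining R}"
proof
  fix T assume T: "T \<in> inv_set"
  show "T \<in> closure {R \<in> inv_set. norm_attaining R}"
  proof (cases "T = 0")
    case True
    then have "norm_attaining T" by (auto simp: norm_attaining_def intro: exI[of _ 0])
    with T show ?thesis by (intro closure_subset[THEN subsetD]) simp
  next
    case False
    show ?thesis unfolding closure_approachable
    proof (intro allI impI)
      fix \<epsilon> :: real assume \<epsilon>: "\<epsilon> > 0"
      define U where "U = (1 / norm T) *\<^sub>R T"
      have U: "U \<in> inv_set" "norm U = 1" using T False by (simp_all add: U_def scaleR_invariant)
      have "0 < \<epsilon> / (2 * norm T)" using \<epsilon> False by simp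
      from norm_attaining_dense_unit[OF qb G U this]
      obtain R where R: "R \<in> inv_set" "norm_attaining R" "norm (R - U) \<le> \<epsilon> / (2 * norm T)" by blast
      have "norm T *\<^sub>R R - T = norm T *\<^sub>R (R - U)" using False by (simp add: U_def scaleR_diff_right)
      then have "norm (norm T *\<^sub>R R - T) = norm T * norm (R - U)" by simp
      also have "\<dots> \<le> norm T * (\<epsilon> / (2 * norm T))" using R(3) by (intro mult_left_mono) auto
      also have "\<dots> < \<epsilon>" using \<epsilon> False by simp
      finally have "dist (norm T *\<^sub>R R) T < \<epsilon>" by (simp add: dist_norm)
      then show "\<exists>R\<in>{R \<in> inv_set. norm_attaining R}. dist R T < \<epsilon>"
        using R(1,2) by (intro bexI[of _ "norm T *\<^sub>R R"]) (auto intro: scaleR_invariant norm_attaining_scaleR)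
    qed
  qed
qed

end

theorem theorem4p17:
  fixes sX :: "'k::real_or_complex \<Rightarrow> 'x::banach \<Rightarrow> 'x"
    and sY :: "'k \<Rightarrow> 'y::banach \<Rightarrow> 'y"
    and G :: "('x \<Rightarrow>\<^sub>L 'x) set"
    and H :: "('y \<Rightarrow>\<^sub>L 'y) set"
  assumes "banach_over sX" and "banach_over sY"
    and "isometry_group sX G" and "compact G"
    and "isometry_group sY H"
    and "quasi_beta TYPE('i) sY H"
  shows "{T \<in> inv_ops sX sY G. adjoint_op T \<in> dual_inv_ops sY sX (adjoint_op ` H)}
    \<subseteq> closure {T \<in> NA_inv sX sY G. adjoint_op T \<in> dual_inv_ops sY sX (adjoint_op ` H)}"
proof -
  interpret X: banach_over sX by fact
  interpret Y: banach_over sY by fact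
  interpret banach_over_pair sX sY G H
    using assms(5) by unfold_locales (simp add: isometry_group_def operator_group_def)
  obtain \<Lambda> :: "'i set" and y ys \<rho> where qb: "quasi_beta_family sY H \<Lambda> y ys \<rho>"
    using assms(6) unfolding quasi_beta_def by blast
  have "{T \<in> inv_ops sX sY G. adjoint_op T \<in> dual_inv_ops sY sX (adjoint_op ` H)} = inv_set"
    and "{T \<in> NA_inv sX sY G. adjoint_op T \<in> dual_inv_ops sY sX (adjoint_op ` H)} = {R \<in> inv_set. norm_attaining R}"
    by (auto simp: invariant_iff_adjoint_invariant NA_inv_def)
  then show ?thesis using norm_attaining_dense[OF qb assms(3,4)] by simp
qed

end
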